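(* Let $G$ be an almost unimodular group with closed subgroup $H\le G$, and let $\rho\colon G\to(0,\infty)$ be a rho-function for the pair $(G,H)$. Then $H$ is almost unimodular if and only if $\{t\in H\colon\rho(t)=\rho(e)\}$ is open in $H$. In particular, all closed normal subgroups of $G$ are almost unimodular.
   Context: Locally compact groups are Hausdorff. $\Delta_G\colon G\to\mathbb{R}_+=(0,\infty)$ is the modular function of a locally compact group $G$, $\mu_G(E\cdot s)=\Delta_G(s)\mu_G(E)$ for a left Haar measure $\mu_G$. $G$ is almost unimodular if $\ker\Delta_G$ is open in $G$. For a closed subgroup $H\le G$, a rho-function for $(G,H)$ is a continuous function $\rho\colon G\to(0,\infty)$ satisfying $\rho(st)=\frac{\Delta_H(t)}{\Delta_G(t)}\rho(s)$ for all $s\in G$, $t\in H$ (such functions always exist). *)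

theory Defs
  imports "HOL-Analysis.Analysis" "HOL-Algebra.Coset"
begin

text \<open>
  Groups are HOL-Algebra groups, and the topology is a separate value of type \<open>'a topology\<close> on the
  carrier. A subgroup \<open>H\<close> is the group \<open>G\<lparr>carrier := H\<rparr>\<close> with the topology \<open>subtopology T H\<close>, so
  that it has Haar measures and a modular function of its own.
\<close>

locale topological_group = group G for G (structure) and T :: "'a topology" +
  assumes topspace_eq: "topspace T = carrier G"
    and continuous_mult: "continuous_map (prod_topology T T) T (\<lambda>(x, y). x \<otimes> y)"
    and continuous_inv: "continuous_map T T (\<lambda>x. inv x)"

locale locally_compact_group = topological_group +
  assumes Hausdorff: "Hausdorff_space T"
    and locally_compact: "locally_compact_space T"

definition borel_sigma :: "'a topology \<Rightarrow> 'a set set" where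
  "borel_sigma T = sigma_sets (topspace T) {U. openin T U}"

text \<open>
  For groups that are not sigma-compact the regularity convention matters: outer regularity is
  required on all Borel sets, inner regularity by compact sets only on open sets.
\<close>

definition radon_measure :: "'a topology \<Rightarrow> 'a measure \<Rightarrow> bool" where
  "radon_measure T \<mu> \<longleftrightarrow>
     space \<mu> = topspace T \<and> sets \<mu> = borel_sigma T \<and>
     (\<forall>K. compactin T K \<longrightarrow> emeasure \<mu> K < \<infinity>) \<and>
     (\<forall>E \<in> sets \<mu>. emeasure \<mu> E = (INF U \<in> {U. openin T U \<and> E \<subseteq> U}. emeasure \<mu> U)) \<and>
     (\<forall>U. openin T U \<longrightarrow> emeasure \<mu> U = (SUP K \<in> {K. compactin T K \<and> K \<subseteq> U}. emeasure \<mu> K))"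

definition left_haar_measure ::
    "('a, 'b) monoid_scheme \<Rightarrow> 'a topology \<Rightarrow> 'a measure \<Rightarrow> bool" where
  "left_haar_measure G T \<mu> \<longleftrightarrow>
     radon_measure T \<mu> \<and> emeasure \<mu> (space \<mu>) \<noteq> 0 \<and>
     (\<forall>s \<in> carrier G. \<forall>E \<in> sets \<mu>. emeasure \<mu> (s <#\<^bsub>G\<^esub> E) = emeasure \<mu> E)"

text \<open>
  By existence and uniqueness of Haar measure, exactly one number \<open>c\<close> is described here when
  \<open>G\<close> is a locally compact group and \<open>s\<close> lies in its carrier.
\<close>

definition modular_function ::
    "('a, 'b) monoid_scheme \<Rightarrow> 'a topology \<Rightarrow> 'a \<Rightarrow> real" where
  "modular_function G T s =
     (THE c. c > 0 \<and>
        (\<forall>\<mu>. left_haar_measure G T \<mu> \<longrightarrow>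
          (\<forall>E \<in> sets \<mu>. emeasure \<mu> (E #>\<^bsub>G\<^esub> s) = ennreal c * emeasure \<mu> E)))"

definition almost_unimodular :: "('a, 'b) monoid_scheme \<Rightarrow> 'a topology \<Rightarrow> bool" where
  "almost_unimodular G T \<longleftrightarrow> openin T {s \<in> carrier G. modular_function G T s = 1}"

definition rho_function ::
    "('a, 'b) monoid_scheme \<Rightarrow> 'a topology \<Rightarrow> 'a set \<Rightarrow> ('a \<Rightarrow> real) \<Rightarrow> bool" where
  "rho_function G T H \<rho> \<longleftrightarrow>
     continuous_map T (top_of_set {0<..}) \<rho> \<and>
     (\<forall>s \<in> carrier G. \<forall>t \<in> H.
        \<rho> (s \<otimes>\<^bsub>G\<^esub> t) =
          modular_function (G\<lparr>carrier := H\<rparr>) (subtopology T H) t / modular_function G T t * \<rho> s)"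

end

theory Submission
  imports Defs
begin

text \<open>
  On \<open>H\<close> the identity \<open>\<rho>(t) = \<Delta>\<^sub>H(t) / \<Delta>\<^sub>G(t) \<rho>(e)\<close> shows that the two sets in question agree on the open
  subgroup \<open>H \<inter> ker \<Delta>\<^sub>G\<close>; since both are subgroups of \<open>H\<close>, one is open iff the other is. For a closed
  normal subgroup \<open>N\<close>, \<open>\<Delta>\<^sub>N\<close> is the restriction of \<open>\<Delta>\<^sub>G\<close>. This is read off from the identity
  \<open>\<integral>\<^sub>G \<phi>(x) \<integral>\<^sub>N f(nx) dn dx = \<integral>\<^sub>G f(x) \<integral>\<^sub>N \<phi>(n\<^sup>-\<^sup>1x) dn dx\<close>, without a Haar measure on \<open>G/N\<close>, by translating
  \<open>f\<close> and \<open>\<phi>\<close> on the right by elements of \<open>N\<close>. The case \<open>N = G\<close> of the same identity, with \<open>\<phi>\<close> concentrated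
  near \<open>e\<close>, gives uniqueness of Haar measure. Existence follows from covering numbers.
\<close>

section \<open>Compactly supported functions and Radon measures\<close>

text \<open>Groups need not be sigma-compact, so Haar measures need not be sigma-finite, and product
  measures are avoided: iterated integrals are interchanged only for continuous integrands vanishing
  off a compact rectangle, where finite step functions suffice. Statements about integrals return to
  Borel sets through regularity. Since \<open>modular_function\<close> is a definite description, it
  says nothing until Haar measure is known to exist and to be unique up to scaling, for the group
  and for the closed subgroup alike.\<close>

lemma continuous_map_real_iff:
  "continuous_map T euclideanreal f \<longleftrightarrow>
     (\<forall>x\<in>topspace T. \<forall>e>0. \<exists>U. openin T U \<and> x \<in> U \<and> (\<forall>y\<in>U. \<bar>f y - f x\<bar> < e))"
  using Met_TC.continuous_map_to_metric[of T f] by (simp add: dist_real_def abs_minus_commute)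

text \<open>A compact set containing the nonzero points stands in for the closed support, and values
  off \<open>topspace T\<close> are unconstrained, so a function on the group restricts to a closed
  subgroup without modification.\<close>

definition Cc :: "'a topology \<Rightarrow> ('a \<Rightarrow> real) set" where
  "Cc T = {f. continuous_map T euclideanreal f \<and>
              (\<exists>K. compactin T K \<and> (\<forall>x\<in>topspace T - K. f x = 0))}"

lemma CcI:
  assumes "continuous_map T euclideanreal f" "compactin T K"
    and "\<And>x. x \<in> topspace T \<Longrightarrow> x \<notin> K \<Longrightarrow> f x = 0"
  shows "f \<in> Cc T"
  using assms unfolding Cc_def by auto

lemma CcE:
  assumes "f \<in> Cc T"
  obtains K where "compactin T K" "\<And>x. x \<in> topspace T \<Longrightarrow> x \<notin> K \<Longrightarrow> f x = 0"
  using assms unfolding Cc_def by auto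

lemma Cc_continuous: "f \<in> Cc T \<Longrightarrow> continuous_map T euclideanreal f"
  unfolding Cc_def by auto

lemma Cc_mult:
  assumes "f \<in> Cc T" "continuous_map T euclideanreal g"
  shows "(\<lambda>x. f x * g x) \<in> Cc T"
proof -
  obtain K where "compactin T K" "\<And>x. x \<in> topspace T \<Longrightarrow> x \<notin> K \<Longrightarrow> f x = 0"
    using CcE[OF assms(1)] by metis
  then show ?thesis
    using assms by (intro CcI[of _ _ K] continuous_map_real_mult) (auto simp: Cc_def)
qed

lemma Cc_bounded:
  assumes "f \<in> Cc T"
  obtains B where "B \<ge> 0" "\<And>x. x \<in> topspace T \<Longrightarrow> \<bar>f x\<bar> \<le> B"
proof -
  obtain K where K: "compactin T K" "\<And>x. x \<in> topspace T \<Longrightarrow> x \<notin> K \<Longrightarrow> f x = 0"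
    using CcE[OF assms] by metis
  have "compact (f ` K)"
    using image_compactin[OF K(1) Cc_continuous[OF assms]] by simp
  then obtain B where B: "\<forall>y\<in>f ` K. \<bar>y\<bar> \<le> B"
    using compact_imp_bounded bounded_real by blast
  have "\<bar>f x\<bar> \<le> max B 0" if "x \<in> topspace T" for x
    using that K(2)[of x] B by (cases "x \<in> K") fastforce+
  then show ?thesis
    using that[of "max B 0"] by auto
qed

text \<open>Complete regularity alone gives no compact support. An open \<open>V\<close> around
  \<open>K\<close>, contained in a compact \<open>L\<close>, is therefore interposed, and
  \<open>f\<close> is made to vanish off \<open>U \<inter> V\<close>, hence off
  \<open>L\<close>.\<close>

lemma locally_compact_Hausdorff_Urysohn:
  assumes "locally_compact_space T" "Hausdorff_space T"
    and K: "compactin T K" and U: "openin T U" "K \<subseteq> U"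
  obtains f where "f \<in> Cc T" "\<And>x. x \<in> topspace T \<Longrightarrow> 0 \<le> f x \<and> f x \<le> (1::real)"
    "\<And>x. x \<in> K \<Longrightarrow> f x = 1" "\<And>x. x \<in> topspace T \<Longrightarrow> x \<notin> U \<Longrightarrow> f x = 0"
proof -
  obtain V L where V: "openin T V" "compactin T L" "K \<subseteq> V" "V \<subseteq> L"
    using locally_compact_space_compact_closed_compact[of T] assms by metis
  have cr: "completely_regular_space T"
    using assms locally_compact_Hausdorff_imp_regular_space
      locally_compact_regular_imp_completely_regular_space by metis
  obtain f where f: "continuous_map T (top_of_set {0..1::real}) f"
    "f ` (topspace T - U \<inter> V) \<subseteq> {0}" "f ` K \<subseteq> {1}"
    by (rule Urysohn_completely_regular_compact_closed
          [OF zero_le_one cr K, of "topspace T - U \<inter> V"])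
       (use U V in \<open>auto simp: disjnt_iff\<close>)
  show thesis
  proof (rule that)
    show "f \<in> Cc T"
      using f(2) V by (intro CcI[OF continuous_map_into_fulltopology[OF f(1)] V(2)]) auto
    show "0 \<le> f x \<and> f x \<le> 1" if "x \<in> topspace T" for x
      using f(1) that by (auto simp: continuous_map_def)
  qed (use f in auto)
qed

text \<open>The parts \<open>K - U\<close> and \<open>K - V\<close> are disjoint compact sets, hence
  have disjoint open neighbourhoods \<open>P\<close> and \<open>Q\<close>. Cutting these out of
  \<open>K\<close> leaves compact sets inside \<open>U\<close> and \<open>V\<close>, and no point is
  lost because \<open>P\<close> and \<open>Q\<close> do not meet.\<close>

lemma compactin_Un_split:
  assumes "Hausdorff_space T" "compactin T K" "openin T U" "openin T V" "K \<subseteq> U \<union> V"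
  obtains A B where "compactin T A" "compactin T B" "A \<subseteq> U" "B \<subseteq> V" "K = A \<union> B"
proof -
  have cl: "closedin T K"
    using assms compactin_imp_closedin by blast
  have "compactin T (K - U)" "compactin T (K - V)"
    using closed_compactin[OF assms(2)] cl assms closedin_diff by (metis Diff_subset)+
  moreover have "disjnt (K - U) (K - V)"
    using assms(5) by (auto simp: disjnt_iff)
  ultimately obtain P Q where PQ: "openin T P" "openin T Q" "K - U \<subseteq> P" "K - V \<subseteq> Q" "disjnt P Q"
    using Hausdorff_space_compact_separation[OF assms(1)] by metis
  show thesis
  proof (rule that[of "K - P" "K - Q"])
    show "compactin T (K - P)" "compactin T (K - Q)"
      using closed_compactin[OF assms(2)] cl PQ closedin_diff by (metis Diff_subset)+
  qed (use PQ in \<open>auto simp: disjnt_iff\<close>)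
qed

section \<open>Integration against a Radon measure\<close>

locale radon =
  fixes T :: "'a topology" and \<mu> :: "'a measure"
  assumes radon: "radon_measure T \<mu>" and hausdorff: "Hausdorff_space T"
begin

lemma space_eq [simp]: "space \<mu> = topspace T"
  using radon by (auto simp: radon_measure_def)

lemma sets_eq: "sets \<mu> = borel_sigma T"
  using radon by (auto simp: radon_measure_def)

lemma open_sets: "openin T U \<Longrightarrow> U \<in> sets \<mu>"
  unfolding sets_eq borel_sigma_def by (auto intro: sigma_sets.Basic)

lemma compact_sets: "compactin T K \<Longrightarrow> K \<in> sets \<mu>"
proof -
  assume "compactin T K"
  then have "closedin T K"
    using compactin_imp_closedin hausdorff by blast
  then have "openin T (topspace T - K)" "K \<subseteq> topspace T"
    by (auto simp: closedin_def)
  then show "K \<in> sets \<mu>"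
    using open_sets sets.compl_sets by (metis double_diff order_refl space_eq)
qed

lemma finite_compact: "compactin T K \<Longrightarrow> emeasure \<mu> K < \<infinity>"
  using radon by (auto simp: radon_measure_def)

lemma outer_regular:
  "E \<in> sets \<mu> \<Longrightarrow> emeasure \<mu> E = (INF U \<in> {U. openin T U \<and> E \<subseteq> U}. emeasure \<mu> U)"
  using radon by (auto simp: radon_measure_def)

lemma inner_regular:
  "openin T U \<Longrightarrow> emeasure \<mu> U = (SUP K \<in> {K. compactin T K \<and> K \<subseteq> U}. emeasure \<mu> K)"
  using radon by (auto simp: radon_measure_def)

lemma continuous_measurable:
  assumes "continuous_map T euclideanreal f"
  shows "f \<in> borel_measurable \<mu>"
proof (rule borel_measurableI)
  fix S :: "real set" assume "open S"
  then have "openin T {x \<in> topspace T. f x \<in> S}"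
    using openin_continuous_map_preimage[OF assms] by simp
  moreover have "{x \<in> topspace T. f x \<in> S} = f -` S \<inter> space \<mu>"
    by auto
  ultimately show "f -` S \<inter> space \<mu> \<in> sets \<mu>"
    using open_sets by metis
qed

lemma integrable_indicator_compact [intro]:
  "compactin T K \<Longrightarrow> integrable \<mu> (indicat_real K)"
  using compact_sets finite_compact by (auto intro: integrable_real_indicator)

lemma integrable_bounded_support:
  assumes "f \<in> borel_measurable \<mu>" and K: "compactin T K"
    and "\<And>x. x \<in> topspace T \<Longrightarrow> \<bar>f x\<bar> \<le> B * indicator K x"
  shows "integrable \<mu> f" and "\<bar>integral\<^sup>L \<mu> f\<bar> \<le> B * measure \<mu> K"
proof -
  have i: "integrable \<mu> (\<lambda>x. B * indicat_real K x)"
    using K by auto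
  show f: "integrable \<mu> f"
    by (rule Bochner_Integration.integrable_bound[OF i assms(1)])
       (use assms(3) in \<open>auto intro!: AE_I2 intro: order_trans[OF _ abs_ge_self]\<close>)
  have "\<bar>integral\<^sup>L \<mu> f\<bar> \<le> integral\<^sup>L \<mu> (\<lambda>x. \<bar>f x\<bar>)"
    by (rule integral_abs_bound)
  also have "\<dots> \<le> integral\<^sup>L \<mu> (\<lambda>x. B * indicat_real K x)"
    using f i assms(3) by (intro integral_mono) auto
  also have "\<dots> = B * measure \<mu> K"
    using compact_sets[OF K] sets.sets_into_space[OF compact_sets[OF K]]
    by (simp add: Int_absorb2)
  finally show "\<bar>integral\<^sup>L \<mu> f\<bar> \<le> B * measure \<mu> K" .
qed

lemma Cc_integrable:
  assumes "f \<in> Cc T"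
  shows "integrable \<mu> f"
proof -
  obtain K where K: "compactin T K" "\<And>x. x \<in> topspace T \<Longrightarrow> x \<notin> K \<Longrightarrow> f x = 0"
    using CcE[OF assms] by metis
  obtain B where B: "B \<ge> 0" "\<And>x. x \<in> topspace T \<Longrightarrow> \<bar>f x\<bar> \<le> B"
    using Cc_bounded[OF assms] by metis
  show ?thesis
    by (rule integrable_bounded_support(1)
          [OF continuous_measurable[OF Cc_continuous[OF assms]] K(1), of B])
       (use K B in \<open>auto split: split_indicator\<close>)
qed

text \<open>The tube lemma around the slice of \<open>x0\<close> over \<open>L\<close> makes
  \<open>F x\<close> uniformly close to \<open>F x0\<close> on \<open>L\<close>, and off
  \<open>L\<close> both vanish. The finite measure of \<open>L\<close> turns this into closeness of
  the integrals.\<close>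

lemma continuous_map_parameter_integral:
  assumes F: "continuous_map (prod_topology S T) euclideanreal (\<lambda>(x, y). F x y)"
    and L: "compactin T L"
    and 0: "\<And>x y. x \<in> topspace S \<Longrightarrow> y \<in> topspace T \<Longrightarrow> y \<notin> L \<Longrightarrow> F x y = 0"
  shows "\<And>x. x \<in> topspace S \<Longrightarrow> F x \<in> Cc T"
    and "\<And>x0 e. x0 \<in> topspace S \<Longrightarrow> e > 0 \<Longrightarrow>
           \<exists>U. openin S U \<and> x0 \<in> U \<and> (\<forall>x\<in>U. \<forall>y\<in>topspace T. \<bar>F x y - F x0 y\<bar> < e)"
    and "continuous_map S euclideanreal (\<lambda>x. \<integral>y. F x y \<partial>\<mu>)"
proof -
  have c: "continuous_map T euclideanreal (F x)" if "x \<in> topspace S" for x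
  proof -
    have "continuous_map T (prod_topology S T) (\<lambda>y. (x, y))"
      using that by (intro continuous_map_pairedI) auto
    from continuous_map_compose[OF this F] show ?thesis
      by (simp add: o_def)
  qed
  show Cc: "F x \<in> Cc T" if "x \<in> topspace S" for x
    using c[OF that] L 0[OF that] by (rule CcI)
  show tube: "\<exists>U. openin S U \<and> x0 \<in> U \<and> (\<forall>x\<in>U. \<forall>y\<in>topspace T. \<bar>F x y - F x0 y\<bar> < e)"
    if x0: "x0 \<in> topspace S" and "e > 0" for x0 e
  proof -
    have "continuous_map (prod_topology S T) euclideanreal (F x0 \<circ> snd)"
      by (rule continuous_map_compose[OF continuous_map_snd c[OF x0]])
    then have "continuous_map (prod_topology S T) euclideanreal
        (\<lambda>p. (case p of (x, y) \<Rightarrow> F x y) - (F x0 \<circ> snd) p)"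
      by (intro continuous_map_diff F)
    then have "openin (prod_topology S T)
        {p \<in> topspace (prod_topology S T). (case p of (x, y) \<Rightarrow> F x y) - (F x0 \<circ> snd) p \<in> {-e<..<e}}"
      by (rule openin_continuous_map_preimage) auto
    moreover have "{x0} \<times> L \<subseteq>
        {p \<in> topspace (prod_topology S T). (case p of (x, y) \<Rightarrow> F x y) - (F x0 \<circ> snd) p \<in> {-e<..<e}}"
      using x0 \<open>e > 0\<close> compactin_subset_topspace[OF L] by auto
    ultimately obtain U V where UV: "openin S U" "x0 \<in> U" "L \<subseteq> V"
      "U \<times> V \<subseteq> {p \<in> topspace (prod_topology S T).
          (case p of (x, y) \<Rightarrow> F x y) - (F x0 \<circ> snd) p \<in> {-e<..<e}}"
      using tube_lemma_right[OF _ L x0] by meson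
    have "\<bar>F x y - F x0 y\<bar> < e" if "x \<in> U" "y \<in> topspace T" for x y
    proof (cases "y \<in> L")
      case True
      then have "(x, y) \<in> U \<times> V"
        using that UV by auto
      then show ?thesis
        using UV(4) by (auto simp: abs_less_iff)
    next
      case False
      then show ?thesis
        using 0 that x0 \<open>e > 0\<close> openin_subset[OF UV(1)] by auto
    qed
    then show ?thesis
      using UV by blast
  qed
  show "continuous_map S euclideanreal (\<lambda>x. \<integral>y. F x y \<partial>\<mu>)"
    unfolding continuous_map_real_iff
  proof (intro ballI allI impI)
    fix x0 and e :: real assume x0: "x0 \<in> topspace S" and "e > 0"
    \<comment> \<open>The summand 1 keeps \<open>d\<close> positive when \<open>L\<close> is a null
      set, and makes the resulting bound strictly smaller than \<open>e\<close>.\<close>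
    define d where "d = e / (measure \<mu> L + 1)"
    have d: "d > 0" "d * measure \<mu> L < e"
      using \<open>e > 0\<close> measure_nonneg[of \<mu> L]
      by (auto simp: d_def pos_divide_less_eq add_nonneg_pos intro!: divide_pos_pos)
    obtain U where U: "openin S U" "x0 \<in> U" "\<forall>x\<in>U. \<forall>y\<in>topspace T. \<bar>F x y - F x0 y\<bar> < d"
      using tube[OF x0 d(1)] by metis
    have "\<bar>(\<integral>y. F x y \<partial>\<mu>) - (\<integral>y. F x0 y \<partial>\<mu>)\<bar> < e" if "x \<in> U" for x
    proof -
      have x: "x \<in> topspace S"
        using that openin_subset[OF U(1)] by auto
      have "(\<integral>y. F x y \<partial>\<mu>) - (\<integral>y. F x0 y \<partial>\<mu>) = (\<integral>y. F x y - F x0 y \<partial>\<mu>)"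
        using Cc_integrable[OF Cc] x x0 by simp
      also have "\<bar>\<dots>\<bar> \<le> d * measure \<mu> L"
        by (rule integrable_bounded_support(2)[OF _ L])
           (use U(3) that 0 x x0 c continuous_measurable in
             \<open>auto split: split_indicator intro: less_imp_le\<close>)
      finally show ?thesis
        using d by linarith
    qed
    then show "\<exists>U. openin S U \<and> x0 \<in> U \<and> (\<forall>x\<in>U. \<bar>(\<integral>y. F x y \<partial>\<mu>) - (\<integral>y. F x0 y \<partial>\<mu>)\<bar> < e)"
      using U by blast
  qed
qed

end

section \<open>Interchange of integrals over compact rectangles\<close>

lemma compact_step_partition:
  assumes "compactin S K" and "\<And>x. x \<in> K \<Longrightarrow> openin S (U x) \<and> x \<in> U x"
  obtains n :: nat and c P where "\<And>i. i < n \<Longrightarrow> c i \<in> K"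
    "\<And>i. i < n \<Longrightarrow> P i = K \<inter> (U (c i) - (\<Union>j<i. U (c j)))" "K = (\<Union>i<n. P i)"
proof -
  obtain D where D: "finite D" "D \<subseteq> K" "K \<subseteq> \<Union>(U ` D)"
  proof -
    have "\<exists>\<F>. finite \<F> \<and> \<F> \<subseteq> U ` K \<and> K \<subseteq> \<Union>\<F>"
      using assms by (intro compactinD[OF assms(1)]) auto
    then show ?thesis
      using that by (metis finite_subset_image)
  qed
  obtain c where c: "bij_betw c {0..<card D} D"
    using ex_bij_betw_nat_finite[OF D(1)] by blast
  \<comment> \<open>Each point goes to the first neighbourhood that contains it. The sample point
    \<open>c i\<close> may then fall into an earlier piece; what links it to \<open>P i\<close> is
    only that \<open>P i\<close> lies in \<open>U (c i)\<close>.\<close>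
  define P where "P i = K \<inter> (U (c i) - (\<Union>j<i. U (c j)))" for i
  have "x \<in> (\<Union>i<card D. P i)" if x: "x \<in> K" for x
  proof -
    obtain d where "d \<in> D" "x \<in> U d"
      using D x by blast
    then have "\<exists>i. i < card D \<and> x \<in> U (c i)"
      using c unfolding bij_betw_def by (metis atLeastLessThan_iff imageE)
    then obtain i where i: "i < card D \<and> x \<in> U (c i)" "\<And>j. j < i \<Longrightarrow> \<not> (j < card D \<and> x \<in> U (c j))"
      using exists_least_iff[of "\<lambda>i. i < card D \<and> x \<in> U (c i)"] by blast
    then have "x \<in> P i"
      using x by (auto simp: P_def)
    then show ?thesis
      using i by auto
  qed
  then have "K = (\<Union>i<card D. P i)"
    by (auto simp: P_def)
  moreover have "c i \<in> K" if "i < card D" for i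
    using that c D(2) by (auto simp: bij_betw_def)
  ultimately show ?thesis
    by (intro that[of "card D" c P] P_def)
qed

lemma sum_indicator_disjoint:
  fixes g :: "'i \<Rightarrow> real"
  assumes "finite I" "disjoint_family_on P I" "i \<in> I" "x \<in> P i"
  shows "(\<Sum>j\<in>I. indicator (P j) x * g j) = g i"
proof -
  have "(\<Sum>j\<in>I. indicator (P j) x * g j) = (\<Sum>j\<in>I. if j = i then g i else 0)"
    using assms by (intro sum.cong) (auto simp: disjoint_family_on_def split: split_indicator)
  then show ?thesis
    using assms by simp
qed

text \<open>Replacing \<open>x\<close> by the sample point of its piece turns the integral over
  \<open>x\<close> into a finite sum, for which the interchange is linearity. Both iterated
  integrals are compared with the same sum \<open>s\<close>; each comparison costs \<open>e\<close>
  times the size of the rectangle, whence the factor 2.\<close>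

lemma Cc_Fubini_approx:
  assumes \<mu>: "radon S \<mu>" and \<nu>: "radon T \<nu>"
    and F: "continuous_map (prod_topology S T) euclideanreal (\<lambda>(x, y). F x y)"
    and F': "continuous_map (prod_topology T S) euclideanreal (\<lambda>(y, x). F x y)"
    and K: "compactin S K" and L: "compactin T L"
    and 0: "\<And>x y. x \<in> topspace S \<Longrightarrow> y \<in> topspace T \<Longrightarrow> x \<notin> K \<or> y \<notin> L \<Longrightarrow> F x y = 0"
    and e: "e > 0"
  shows "\<bar>(\<integral>x. (\<integral>y. F x y \<partial>\<nu>) \<partial>\<mu>) - (\<integral>y. (\<integral>x. F x y \<partial>\<mu>) \<partial>\<nu>)\<bar>
     \<le> e * (2 * measure \<nu> L * measure \<mu> K)"
proof -
  interpret \<mu>: radon S \<mu> by fact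
  interpret \<nu>: radon T \<nu> by fact
  have pF: "\<And>x. x \<in> topspace S \<Longrightarrow> F x \<in> Cc T"
    "\<And>x0. x0 \<in> topspace S \<Longrightarrow> \<exists>U. openin S U \<and> x0 \<in> U \<and> (\<forall>x\<in>U. \<forall>y\<in>topspace T. \<bar>F x y - F x0 y\<bar> < e)"
    "continuous_map S euclideanreal (\<lambda>x. \<integral>y. F x y \<partial>\<nu>)"
    using \<nu>.continuous_map_parameter_integral[OF F L] 0 e by simp_all
  have pF': "\<And>y. y \<in> topspace T \<Longrightarrow> (\<lambda>x. F x y) \<in> Cc S"
    "continuous_map T euclideanreal (\<lambda>y. \<integral>x. F x y \<partial>\<mu>)"
    using \<mu>.continuous_map_parameter_integral[OF F' K] 0 by simp_all
  have KS: "K \<subseteq> topspace S" and LT: "L \<subseteq> topspace T"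
    using K L compactin_subset_topspace by auto
  have "\<forall>x\<in>K. \<exists>U. openin S U \<and> x \<in> U \<and> (\<forall>x'\<in>U. \<forall>y\<in>topspace T. \<bar>F x' y - F x y\<bar> < e)"
    using pF(2) KS by blast
  then obtain U where U: "\<And>x. x \<in> K \<Longrightarrow> openin S (U x) \<and> x \<in> U x"
    "\<And>x x' y. x \<in> K \<Longrightarrow> x' \<in> U x \<Longrightarrow> y \<in> topspace T \<Longrightarrow> \<bar>F x' y - F x y\<bar> < e"
    by metis
  obtain n :: nat and c P where P: "\<And>i. i < n \<Longrightarrow> c i \<in> K"
    "\<And>i. i < n \<Longrightarrow> P i = K \<inter> (U (c i) - (\<Union>j<i. U (c j)))" "K = (\<Union>i<n. P i)"
    using compact_step_partition[OF K, of U] U(1) by metis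
  have Psets: "P i \<in> sets \<mu>" if "i < n" for i
    unfolding P(2)[OF that] using \<mu>.compact_sets[OF K] \<mu>.open_sets U(1) P(1) that
    by (intro sets.Int sets.Diff sets.finite_UN) auto
  have Pdisj: "disjoint_family_on P {..<n}"
    unfolding disjoint_family_on_def
  proof (intro ballI impI)
    fix i j assume "i \<in> {..<n}" "j \<in> {..<n}" "i \<noteq> j"
    then show "P i \<inter> P j = {}"
      using P(2)[of i] P(2)[of j] by (cases "i < j") fastforce+
  qed
  have PK: "P i \<subseteq> K" if "i < n" for i
    using P(2)[OF that] by auto
  have Pi: "integrable \<mu> (indicat_real (P i))" if "i < n" for i
    using Psets[OF that] PK[OF that] emeasure_mono[OF PK[OF that] \<mu>.compact_sets[OF K]]
      \<mu>.finite_compact[OF K] by (intro integrable_real_indicator) (auto intro: le_less_trans)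
  have Pm: "(\<integral>x. indicat_real (P i) x \<partial>\<mu>) = measure \<mu> (P i)" if "i < n" for i
    using sets.sets_into_space[OF Psets[OF that]] by (simp add: Int_absorb2)
  have iS: "integrable \<mu> (\<lambda>x. \<Sum>i<n. indicator (P i) x * g i)" for g :: "nat \<Rightarrow> real"
    using Pi by (intro Bochner_Integration.integrable_sum integrable_mult_left) auto
  define J where "J x = (\<integral>y. F x y \<partial>\<nu>)" for x
  define s where "s = (\<Sum>i<n. measure \<mu> (P i) * J (c i))"
  \<comment> \<open>Used at two levels: for the inner integral \<open>J\<close> with bound
    \<open>e * measure \<nu> L\<close>, and for \<open>F\<close> at a fixed \<open>y\<close> with
    bound \<open>e\<close>.\<close>
  have step: "\<bar>g x - (\<Sum>i<n. indicator (P i) x * g (c i))\<bar> \<le> b * indicator K x"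
    if "x \<in> topspace S" "x \<notin> K \<Longrightarrow> g x = 0" "\<And>i. i < n \<Longrightarrow> x \<in> P i \<Longrightarrow> \<bar>g x - g (c i)\<bar> \<le> b"
    for g :: "'a \<Rightarrow> real" and b x
  proof (cases "x \<in> K")
    case True
    then obtain i where i: "i < n" "x \<in> P i"
      using P(3) by auto
    have "(\<Sum>i<n. indicator (P i) x * g (c i)) = g (c i)"
      using sum_indicator_disjoint[of "{..<n}" P i x "\<lambda>i. g (c i)"] Pdisj i by auto
    then show ?thesis
      using that(3)[OF i] True by simp
  next
    case False
    then have "(\<Sum>i<n. indicator (P i) x * g (c i)) = 0"
      using PK by (intro sum.neutral) (auto split: split_indicator)
    then show ?thesis
      using False that(2) by simp
  qed
  have close: "\<bar>F x y - F (c i) y\<bar> \<le> e" if "i < n" "x \<in> P i" "y \<in> topspace T" for i x y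
    using U(2)[OF P(1)[OF that(1)] _ that(3)] that(2) P(2)[OF that(1)] by (auto intro: less_imp_le)
  have cS: "c i \<in> topspace S" if "i < n" for i
    using that P(1) KS by auto
  have 1: "\<bar>(\<integral>x. J x \<partial>\<mu>) - s\<bar> \<le> (e * measure \<nu> L) * measure \<mu> K"
  proof -
    have Jc: "continuous_map S euclideanreal J"
      unfolding J_def by (rule pF(3))
    have J0: "J x = 0" if "x \<in> topspace S" "x \<notin> K" for x
    proof -
      have "J x = (\<integral>y. 0 \<partial>\<nu>)"
        unfolding J_def using 0 that by (intro Bochner_Integration.integral_cong) auto
      then show ?thesis by simp
    qed
    have JCc: "J \<in> Cc S"
      using CcI[OF Jc K J0] by blast
    have "s = (\<integral>x. (\<Sum>i<n. indicator (P i) x * J (c i)) \<partial>\<mu>)"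
      unfolding s_def using Pi Pm by (subst Bochner_Integration.integral_sum) auto
    then have "(\<integral>x. J x \<partial>\<mu>) - s = (\<integral>x. J x - (\<Sum>i<n. indicator (P i) x * J (c i)) \<partial>\<mu>)"
      using Bochner_Integration.integral_diff[OF \<mu>.Cc_integrable[OF JCc] iS] by simp
    also have "\<bar>\<dots>\<bar> \<le> (e * measure \<nu> L) * measure \<mu> K"
    proof (rule \<mu>.integrable_bounded_support(2)[OF _ K])
      show "(\<lambda>x. J x - (\<Sum>i<n. indicator (P i) x * J (c i))) \<in> borel_measurable \<mu>"
        using \<mu>.continuous_measurable[OF Jc] Psets by measurable
      fix x assume x: "x \<in> topspace S"
      show "\<bar>J x - (\<Sum>i<n. indicator (P i) x * J (c i))\<bar> \<le> e * measure \<nu> L * indicator K x"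
      proof (rule step[OF x])
        fix i assume i: "i < n" "x \<in> P i"
        have "J x - J (c i) = (\<integral>y. F x y - F (c i) y \<partial>\<nu>)"
          unfolding J_def using \<nu>.Cc_integrable[OF pF(1)] x cS i by simp
        also have "\<bar>\<dots>\<bar> \<le> e * measure \<nu> L"
          by (rule \<nu>.integrable_bounded_support(2)[OF _ L])
             (use close[OF i] 0 x cS[OF i(1)] Cc_continuous[OF pF(1)] \<nu>.continuous_measurable in
               \<open>auto split: split_indicator\<close>)
        finally show "\<bar>J x - J (c i)\<bar> \<le> e * measure \<nu> L" .
      qed (use J0 x in auto)
    qed
    finally show ?thesis .
  qed
  have 2: "\<bar>(\<integral>y. (\<integral>x. F x y \<partial>\<mu>) \<partial>\<nu>) - s\<bar> \<le> (e * measure \<mu> K) * measure \<nu> L"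
  proof -
    define J' where "J' y = (\<integral>x. F x y \<partial>\<mu>)" for y
    have Jc: "continuous_map T euclideanreal J'"
      unfolding J'_def by (rule pF'(2))
    have J0: "J' y = 0" if "y \<in> topspace T" "y \<notin> L" for y
    proof -
      have "J' y = (\<integral>x. 0 \<partial>\<mu>)"
        unfolding J'_def using 0 that by (intro Bochner_Integration.integral_cong) auto
      then show ?thesis by simp
    qed
    have JCc: "J' \<in> Cc T"
      using CcI[OF Jc L J0] by blast
    have Fc: "integrable \<nu> (F (c i))" if "i < n" for i
      using \<nu>.Cc_integrable[OF pF(1)] cS[OF that] by auto
    \<comment> \<open>The same \<open>s\<close> from the other side: a finite combination of values
      of \<open>J\<close> is one integral over \<open>y\<close> of a finite sum.\<close>
    have "s = (\<integral>y. (\<Sum>i<n. measure \<mu> (P i) * F (c i) y) \<partial>\<nu>)"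
      unfolding s_def J_def using Fc by (subst Bochner_Integration.integral_sum) auto
    then have "(\<integral>y. J' y \<partial>\<nu>) - s = (\<integral>y. J' y - (\<Sum>i<n. measure \<mu> (P i) * F (c i) y) \<partial>\<nu>)"
      using Fc \<nu>.Cc_integrable[OF JCc] by (subst Bochner_Integration.integral_diff) auto
    also have "\<bar>\<dots>\<bar> \<le> (e * measure \<mu> K) * measure \<nu> L"
    proof (rule \<nu>.integrable_bounded_support(2)[OF _ L])
      show "(\<lambda>y. J' y - (\<Sum>i<n. measure \<mu> (P i) * F (c i) y)) \<in> borel_measurable \<nu>"
        using \<nu>.continuous_measurable[OF Jc] Fc by measurable
      fix y assume y: "y \<in> topspace T"
      show "\<bar>J' y - (\<Sum>i<n. measure \<mu> (P i) * F (c i) y)\<bar> \<le> e * measure \<mu> K * indicator L y"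
      proof (cases "y \<in> L")
        case False
        then show ?thesis
          using y J0 0 cS by auto
      next
        case True
        have "(\<Sum>i<n. measure \<mu> (P i) * F (c i) y)
            = (\<integral>x. (\<Sum>i<n. indicator (P i) x * F (c i) y) \<partial>\<mu>)"
          using Pi Pm by (subst Bochner_Integration.integral_sum) auto
        then have "J' y - (\<Sum>i<n. measure \<mu> (P i) * F (c i) y)
           = (\<integral>x. F x y - (\<Sum>i<n. indicator (P i) x * F (c i) y) \<partial>\<mu>)"
          unfolding J'_def
          using Bochner_Integration.integral_diff[OF \<mu>.Cc_integrable[OF pF'(1)[OF y]] iS[of "\<lambda>i. F (c i) y"]]
          by simp
        also have "\<bar>\<dots>\<bar> \<le> e * measure \<mu> K"
        proof (rule \<mu>.integrable_bounded_support(2)[OF _ K])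
          show "(\<lambda>x. F x y - (\<Sum>i<n. indicator (P i) x * F (c i) y)) \<in> borel_measurable \<mu>"
            using \<mu>.continuous_measurable[OF Cc_continuous[OF pF'(1)]] y Psets by measurable
          fix x assume x: "x \<in> topspace S"
          show "\<bar>F x y - (\<Sum>i<n. indicator (P i) x * F (c i) y)\<bar> \<le> e * indicator K x"
            by (rule step[OF x]) (use 0 x y close in auto)
        qed
        finally show ?thesis
          using True by simp
      qed
    qed
    finally show ?thesis
      unfolding J'_def .
  qed
  show ?thesis
    using 1 2 unfolding J_def by (simp add: algebra_simps abs_le_iff)
qed

text \<open>\<open>K\<close> and \<open>L\<close> are fixed before \<open>e\<close> is chosen, so
  the error can be made arbitrarily small; dividing by \<open>M + 1\<close> allows for
  \<open>M = 0\<close>.\<close>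

lemma Cc_Fubini:
  assumes \<mu>: "radon S \<mu>" and \<nu>: "radon T \<nu>"
    and F: "continuous_map (prod_topology S T) euclideanreal (\<lambda>(x, y). F x y)"
    and K: "compactin S K" and L: "compactin T L"
    and 0: "\<And>x y. x \<in> topspace S \<Longrightarrow> y \<in> topspace T \<Longrightarrow> x \<notin> K \<or> y \<notin> L \<Longrightarrow> F x y = 0"
  shows "(\<integral>x. (\<integral>y. F x y \<partial>\<nu>) \<partial>\<mu>) = (\<integral>y. (\<integral>x. F x y \<partial>\<mu>) \<partial>\<nu>)"
proof -
  have F': "continuous_map (prod_topology T S) euclideanreal (\<lambda>(y, x). F x y)"
  proof -
    have "continuous_map (prod_topology T S) (prod_topology S T) (\<lambda>p. (snd p, fst p))"
      by (intro continuous_map_pairedI continuous_map_fst continuous_map_snd)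
    from continuous_map_compose[OF this F] show ?thesis
      by (simp add: o_def case_prod_unfold)
  qed
  let ?d = "\<bar>(\<integral>x. (\<integral>y. F x y \<partial>\<nu>) \<partial>\<mu>) - (\<integral>y. (\<integral>x. F x y \<partial>\<mu>) \<partial>\<nu>)\<bar>"
  define M where "M = 2 * measure \<nu> L * measure \<mu> K"
  have "?d \<le> 0 + e" if "e > 0" for e
  proof -
    have "M \<ge> 0" by (simp add: M_def)
    then have "e / (M + 1) > 0"
      using that by simp
    from Cc_Fubini_approx[OF \<mu> \<nu> F F' K L 0 this]
    have "?d \<le> e / (M + 1) * M"
      unfolding M_def by blast
    also have "\<dots> \<le> e"
      using that \<open>M \<ge> 0\<close> by (simp add: field_simps)
    finally show ?thesis by simp
  qed
  then have "?d \<le> 0"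
    by (rule field_le_epsilon)
  then show ?thesis by simp
qed

section \<open>Radon measures: transport along homeomorphisms, comparison through integrals\<close>

lemma homeomorphic_maps_preimage_eq:
  assumes "homeomorphic_maps T T' h g" "E \<subseteq> topspace T'"
  shows "h -` E \<inter> topspace T = g ` E"
  using assms unfolding homeomorphic_maps_def continuous_map_def by (auto simp: image_iff Pi_iff) (metis subsetD)

lemma Cc_homeomorphic_compose:
  assumes h: "homeomorphic_maps T T' h g" and f: "f \<in> Cc T'"
  shows "(\<lambda>x. f (h x)) \<in> Cc T"
proof -
  obtain K where K: "compactin T' K" "\<And>x. x \<in> topspace T' \<Longrightarrow> x \<notin> K \<Longrightarrow> f x = 0"
    using CcE[OF f] by metis
  show ?thesis
  proof (rule CcI)
    show "continuous_map T euclideanreal (\<lambda>x. f (h x))"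
      using continuous_map_compose[of T T' h euclideanreal f] h Cc_continuous[OF f]
      by (simp add: homeomorphic_maps_def o_def)
    show "compactin T (g ` K)"
      using image_compactin[OF K(1)] h by (auto simp: homeomorphic_maps_def)
    show "f (h x) = 0" if "x \<in> topspace T" "x \<notin> g ` K" for x
    proof (rule K(2))
      show "h x \<in> topspace T'"
        using h that by (auto simp: homeomorphic_maps_def continuous_map_def)
      show "h x \<notin> K"
        using h that unfolding homeomorphic_maps_def by force
    qed
  qed
qed

context radon
begin

lemma homeomorphic_measurable:
  assumes h: "homeomorphic_maps T T h g"
  shows "h \<in> measurable \<mu> \<mu>"
proof (rule measurable_sigma_sets)
  show "sets \<mu> = sigma_sets (topspace T) {U. openin T U}"
    using sets_eq by (simp add: borel_sigma_def)
  show "{U. openin T U} \<subseteq> Pow (topspace T)"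
    using openin_subset by auto
  have c: "continuous_map T T h"
    using h by (simp add: homeomorphic_maps_def)
  then show "h \<in> space \<mu> \<rightarrow> topspace T"
    by (auto simp: continuous_map_def)
  fix U assume "U \<in> {U. openin T U}"
  then have "openin T {x \<in> topspace T. h x \<in> U}"
    using openin_continuous_map_preimage[OF c] by auto
  moreover have "{x \<in> topspace T. h x \<in> U} = h -` U \<inter> space \<mu>"
    by auto
  ultimately show "h -` U \<inter> space \<mu> \<in> sets \<mu>"
    using open_sets by metis
qed

lemma homeomorphic_image_sets:
  assumes h: "homeomorphic_maps T T h g" and E: "E \<in> sets \<mu>"
  shows "g ` E \<in> sets \<mu>"
  using measurable_sets[OF homeomorphic_measurable[OF h] E] sets.sets_into_space[OF E]
    homeomorphic_maps_preimage_eq[OF h, of E] by simp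

lemma emeasure_distr_homeomorphic:
  assumes h: "homeomorphic_maps T T h g" and E: "E \<in> sets \<mu>"
  shows "emeasure (distr \<mu> \<mu> h) E = emeasure \<mu> (g ` E)"
  using emeasure_distr[OF homeomorphic_measurable[OF h] E] sets.sets_into_space[OF E]
    homeomorphic_maps_preimage_eq[OF h, of E] by simp

text \<open>The maps \<open>h\<close> and \<open>g\<close> exchange the open sets around
  \<open>E\<close> with those around \<open>g\<close>
  E\<open>, and the compact sets inside\<close>U\<open>with those inside\<close>g \<open>U\<close>,
  so the infima and suprema of the two regularity conditions range over matching families.\<close>

lemma radon_distr:
  assumes h: "homeomorphic_maps T T h g"
  shows "radon_measure T (distr \<mu> \<mu> h)"
proof -
  have g: "homeomorphic_maps T T g h"
    using h homeomorphic_maps_sym by blast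
  have oh: "openin T (h ` U)" "openin T (g ` U)" if "openin T U" for U
    using h g that homeomorphic_imp_open_map homeomorphic_map_maps by (metis open_map_def)+
  have ch: "compactin T (h ` K)" "compactin T (g ` K)" if "compactin T K" for K
    using h g that image_compactin by (metis homeomorphic_maps_def)+
  have hg: "h ` g ` E = E" "g ` h ` E = E" if "E \<subseteq> topspace T" for E
    using h that unfolding homeomorphic_maps_def by (force simp: image_image)+
  note em = emeasure_distr_homeomorphic[OF h]
  show ?thesis
    unfolding radon_measure_def
  proof (intro conjI ballI allI impI)
    show "emeasure (distr \<mu> \<mu> h) K < \<infinity>" if "compactin T K" for K
      using em[OF compact_sets[OF that]] finite_compact[OF ch(2)[OF that]] by simp
    show "emeasure (distr \<mu> \<mu> h) E = (INF U\<in>{U. openin T U \<and> E \<subseteq> U}. emeasure (distr \<mu> \<mu> h) U)"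
      if "E \<in> sets (distr \<mu> \<mu> h)" for E
    proof -
      have E: "E \<in> sets \<mu>" "E \<subseteq> topspace T"
        using that sets.sets_into_space by fastforce+
      have "emeasure (distr \<mu> \<mu> h) E = (INF U\<in>{U. openin T U \<and> g ` E \<subseteq> U}. emeasure \<mu> U)"
        using em[OF E(1)] outer_regular[OF homeomorphic_image_sets[OF h E(1)]] by simp
      also have "\<dots> = (INF U\<in>{U. openin T U \<and> E \<subseteq> U}. emeasure (distr \<mu> \<mu> h) U)"
      proof (intro INF_eq)
        fix U assume "U \<in> {U. openin T U \<and> g ` E \<subseteq> U}"
        then have U: "openin T U" "g ` E \<subseteq> U" by auto
        have "E \<subseteq> h ` U"
          using image_mono[OF U(2), of h] hg(1)[OF E(2)] by simp
        moreover have "emeasure (distr \<mu> \<mu> h) (h ` U) = emeasure \<mu> U"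
          using em[OF open_sets[OF oh(1)[OF U(1)]]] hg(2)[OF openin_subset[OF U(1)]] by simp
        ultimately show "\<exists>V\<in>{U. openin T U \<and> E \<subseteq> U}. emeasure (distr \<mu> \<mu> h) V \<le> emeasure \<mu> U"
          using oh(1)[OF U(1)] by (intro bexI[of _ "h ` U"]) auto
      next
        fix U assume "U \<in> {U. openin T U \<and> E \<subseteq> U}"
        then have U: "openin T U" "E \<subseteq> U" by auto
        then show "\<exists>V\<in>{U. openin T U \<and> g ` E \<subseteq> U}. emeasure \<mu> V \<le> emeasure (distr \<mu> \<mu> h) U"
          using oh(2)[OF U(1)] em[OF open_sets[OF U(1)]] by (intro bexI[of _ "g ` U"]) auto
      qed
      finally show ?thesis .
    qed
    show "emeasure (distr \<mu> \<mu> h) U = (SUP K\<in>{K. compactin T K \<and> K \<subseteq> U}. emeasure (distr \<mu> \<mu> h) K)"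
      if U: "openin T U" for U
    proof -
      have "emeasure (distr \<mu> \<mu> h) U = (SUP K\<in>{K. compactin T K \<and> K \<subseteq> g ` U}. emeasure \<mu> K)"
        using em[OF open_sets[OF U]] inner_regular[OF oh(2)[OF U]] by simp
      also have "\<dots> = (SUP K\<in>{K. compactin T K \<and> K \<subseteq> U}. emeasure (distr \<mu> \<mu> h) K)"
      proof (intro SUP_eq)
        fix K assume "K \<in> {K. compactin T K \<and> K \<subseteq> g ` U}"
        then have K: "compactin T K" "K \<subseteq> g ` U" by auto
        have "h ` K \<subseteq> U"
          using image_mono[OF K(2), of h] hg(1)[OF openin_subset[OF U]] by simp
        moreover have "emeasure (distr \<mu> \<mu> h) (h ` K) = emeasure \<mu> K"
          using em[OF compact_sets[OF ch(1)[OF K(1)]]] hg(2)[OF compactin_subset_topspace[OF K(1)]] by simp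
        ultimately show "\<exists>L\<in>{K. compactin T K \<and> K \<subseteq> U}. emeasure \<mu> K \<le> emeasure (distr \<mu> \<mu> h) L"
          using ch(1)[OF K(1)] by (intro bexI[of _ "h ` K"]) auto
      next
        fix K assume "K \<in> {K. compactin T K \<and> K \<subseteq> U}"
        then have K: "compactin T K" "K \<subseteq> U" by auto
        then show "\<exists>L\<in>{K. compactin T K \<and> K \<subseteq> g ` U}. emeasure (distr \<mu> \<mu> h) K \<le> emeasure \<mu> L"
          using ch(2)[OF K(1)] em[OF compact_sets[OF K(1)]] by (intro bexI[of _ "g ` K"]) auto
      qed
      finally show ?thesis .
    qed
  qed (use sets_eq in auto)
qed

end

text \<open>A Urysohn function for a compact set inside an open set lies between their indicators.
  Inner regularity then settles open sets and outer regularity all Borel sets. Equality will come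
  from exchanging the measures and inverting \<open>c\<close>.\<close>

lemma radon_le_of_Cc_integral:
  assumes \<mu>: "radon T \<mu>" and \<nu>: "radon T \<nu>" and lc: "locally_compact_space T" and "c \<ge> 0"
    and c: "\<And>f. f \<in> Cc T \<Longrightarrow> integral\<^sup>L \<nu> f = c * integral\<^sup>L \<mu> f"
    and E: "E \<in> sets \<mu>"
  shows "emeasure \<nu> E \<le> ennreal c * emeasure \<mu> E"
proof -
  interpret \<mu>: radon T \<mu> by fact
  interpret \<nu>: radon T \<nu> by fact
  have U: "emeasure \<nu> U \<le> ennreal c * emeasure \<mu> U" if U: "openin T U" for U
    unfolding \<nu>.inner_regular[OF U]
  proof (intro SUP_least)
    fix K assume "K \<in> {K. compactin T K \<and> K \<subseteq> U}"
    then have K: "compactin T K" "K \<subseteq> U" by auto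
    then obtain f where f: "f \<in> Cc T" "\<And>x. x \<in> topspace T \<Longrightarrow> 0 \<le> f x \<and> f x \<le> (1::real)"
      "\<And>x. x \<in> K \<Longrightarrow> f x = 1" "\<And>x. x \<in> topspace T \<Longrightarrow> x \<notin> U \<Longrightarrow> f x = 0"
      using locally_compact_Hausdorff_Urysohn[OF lc \<mu>.hausdorff _ U] by metis
    have "emeasure \<nu> K = (\<integral>\<^sup>+x. indicator K x \<partial>\<nu>)"
      using \<nu>.compact_sets[OF K(1)] by simp
    also have "\<dots> \<le> (\<integral>\<^sup>+x. ennreal (f x) \<partial>\<nu>)"
      using f by (intro nn_integral_mono) (auto split: split_indicator)
    also have "\<dots> = ennreal (integral\<^sup>L \<nu> f)"
      using f \<nu>.Cc_integrable[OF f(1)] by (intro nn_integral_eq_integral) auto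
    also have "\<dots> = ennreal c * ennreal (integral\<^sup>L \<mu> f)"
    proof -
      have "integral\<^sup>L \<mu> f \<ge> 0"
        using f(2) by (intro Bochner_Integration.integral_nonneg) auto
      then show ?thesis
        using c[OF f(1)] \<open>c \<ge> 0\<close> by (simp add: ennreal_mult)
    qed
    also have "ennreal (integral\<^sup>L \<mu> f) = (\<integral>\<^sup>+x. ennreal (f x) \<partial>\<mu>)"
      using f \<mu>.Cc_integrable[OF f(1)] by (intro nn_integral_eq_integral[symmetric]) auto
    also have "ennreal c * \<dots> \<le> ennreal c * (\<integral>\<^sup>+x. indicator U x \<partial>\<mu>)"
      using f by (intro mult_left_mono nn_integral_mono) (auto split: split_indicator)
    finally show "emeasure \<nu> K \<le> ennreal c * emeasure \<mu> U"
      using \<mu>.open_sets[OF U] by simp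
  qed
  have E': "E \<in> sets \<nu>"
    using E \<mu>.sets_eq \<nu>.sets_eq by simp
  show ?thesis
  proof (cases "c = 0")
    \<comment> \<open>The right side is 0 even where \<open>\<mu>\<close> is infinite, so
      \<open>\<nu>\<close> has to vanish on the whole space.\<close>
    case True
    have "emeasure \<nu> E \<le> emeasure \<nu> (topspace T)"
      using emeasure_space[of \<nu> E] by simp
    also have "\<dots> \<le> 0"
      using U[OF openin_topspace] True by simp
    finally show ?thesis by simp
  next
    case False
    have "emeasure \<nu> E / ennreal c \<le> emeasure \<mu> E"
      unfolding \<mu>.outer_regular[OF E]
    proof (intro INF_greatest)
      fix V assume "V \<in> {U. openin T U \<and> E \<subseteq> U}"
      then have V: "openin T V" "E \<subseteq> V" by auto
      have "emeasure \<nu> E \<le> emeasure \<nu> V"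
        using V \<nu>.open_sets by (intro emeasure_mono) auto
      also have "\<dots> \<le> ennreal c * emeasure \<mu> V"
        using U[OF V(1)] .
      finally show "emeasure \<nu> E / ennreal c \<le> emeasure \<mu> V"
        using False \<open>c \<ge> 0\<close> by (intro divide_le_posI_ennreal) (auto simp: ac_simps)
    qed
    then have "ennreal c * (emeasure \<nu> E / ennreal c) \<le> ennreal c * emeasure \<mu> E"
      by (rule mult_left_mono) simp
    moreover have "ennreal c * (emeasure \<nu> E / ennreal c) = emeasure \<nu> E"
      using False \<open>c \<ge> 0\<close> ennreal_mult_divide_eq[of "ennreal c" "emeasure \<nu> E"]
      by (simp add: ennreal_times_divide mult.commute)
    ultimately show ?thesis by simp
  qed
qed

lemma radon_eq_of_Cc_integral:
  assumes \<mu>: "radon T \<mu>" and \<nu>: "radon T \<nu>" and lc: "locally_compact_space T" and "c > 0"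
    and c: "\<And>f. f \<in> Cc T \<Longrightarrow> integral\<^sup>L \<nu> f = c * integral\<^sup>L \<mu> f"
    and E: "E \<in> sets \<mu>"
  shows "emeasure \<nu> E = ennreal c * emeasure \<mu> E"
proof (rule antisym)
  show "emeasure \<nu> E \<le> ennreal c * emeasure \<mu> E"
    using radon_le_of_Cc_integral[OF \<mu> \<nu> lc _ c E] \<open>c > 0\<close> by simp
  have "sets \<mu> = sets \<nu>"
    using radon.sets_eq[OF \<mu>] radon.sets_eq[OF \<nu>] by simp
  then have "emeasure \<mu> E \<le> ennreal (inverse c) * emeasure \<nu> E"
    using \<open>c > 0\<close> E by (intro radon_le_of_Cc_integral[OF \<nu> \<mu> lc]) (auto simp: c)
  then have "ennreal c * emeasure \<mu> E \<le> ennreal c * (ennreal (inverse c) * emeasure \<nu> E)"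
    by (rule mult_left_mono) simp
  also have "\<dots> = emeasure \<nu> E"
    using \<open>c > 0\<close> by (simp add: mult.assoc[symmetric] ennreal_mult[symmetric])
  finally show "ennreal c * emeasure \<mu> E \<le> emeasure \<nu> E" .
qed

section \<open>Topological groups and their subgroups\<close>

context topological_group
begin

lemma continuous_map_group_mult:
  assumes "continuous_map X T f" "continuous_map X T g"
  shows "continuous_map X T (\<lambda>x. f x \<otimes> g x)"
  using continuous_map_compose[OF continuous_map_pairedI[OF assms] continuous_mult] by (simp add: o_def)

lemma continuous_map_group_inv:
  assumes "continuous_map X T f"
  shows "continuous_map X T (\<lambda>x. inv (f x))"
  using continuous_map_compose[OF assms continuous_inv] by (simp add: o_def)

lemma homeomorphic_maps_left_translation:
  assumes "a \<in> carrier G"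
  shows "homeomorphic_maps T T (\<lambda>x. a \<otimes> x) (\<lambda>x. inv a \<otimes> x)"
  using assms unfolding homeomorphic_maps_def
  by (auto intro!: continuous_map_group_mult simp: topspace_eq m_assoc[symmetric])

lemma homeomorphic_maps_right_translation:
  assumes "a \<in> carrier G"
  shows "homeomorphic_maps T T (\<lambda>x. x \<otimes> a) (\<lambda>x. x \<otimes> inv a)"
  using assms unfolding homeomorphic_maps_def
  by (auto intro!: continuous_map_group_mult simp: topspace_eq m_assoc)

lemma homeomorphic_maps_inv: "homeomorphic_maps T T (\<lambda>x. inv x) (\<lambda>x. inv x)"
  unfolding homeomorphic_maps_def by (auto simp: topspace_eq intro: continuous_inv)

lemma openin_l_coset:
  assumes "a \<in> carrier G" "openin T U"
  shows "openin T (a <# U)"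
proof -
  have "openin T ((\<lambda>x. a \<otimes> x) ` U)"
    using homeomorphic_maps_left_translation[OF assms(1)] assms(2) homeomorphic_imp_open_map
      homeomorphic_map_maps by (metis open_map_def)
  moreover have "(\<lambda>x. a \<otimes> x) ` U = a <# U"
    by (auto simp: l_coset_def)
  ultimately show ?thesis by simp
qed

lemma topological_group_subgroup:
  assumes H: "subgroup H G"
  shows "topological_group (G\<lparr>carrier := H\<rparr>) (subtopology T H)"
proof -
  interpret H: group "G\<lparr>carrier := H\<rparr>"
    using H subgroup_imp_group by blast
  have sub: "H \<subseteq> carrier G"
    using H subgroup.subset by blast
  have id: "continuous_map (subtopology T H) T (\<lambda>x. x)"
    using continuous_map_from_subtopology[OF continuous_map_id] by (simp add: id_def)
  show ?thesis
  proof
    show "topspace (subtopology T H) = carrier (G\<lparr>carrier := H\<rparr>)"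
      using sub topspace_eq by auto
    have "continuous_map (prod_topology (subtopology T H) (subtopology T H)) T (\<lambda>p. fst p \<otimes> snd p)"
      using continuous_map_compose[OF continuous_map_fst id] continuous_map_compose[OF continuous_map_snd id]
      by (intro continuous_map_group_mult) (auto simp: o_def)
    then show "continuous_map (prod_topology (subtopology T H) (subtopology T H)) (subtopology T H)
        (\<lambda>(x, y). x \<otimes>\<^bsub>G\<lparr>carrier := H\<rparr>\<^esub> y)"
      using subgroup.m_closed[OF H] by (auto simp: continuous_map_in_subtopology case_prod_unfold)
    have "continuous_map (subtopology T H) (subtopology T H) (\<lambda>x. inv x)"
      using continuous_map_group_inv[OF id] subgroup.m_inv_closed[OF H]
      by (auto simp: continuous_map_in_subtopology)
    then show "continuous_map (subtopology T H) (subtopology T H) (\<lambda>x. inv\<^bsub>G\<lparr>carrier := H\<rparr>\<^esub> x)"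
      by (rule continuous_map_eq) (use H in \<open>auto simp: m_inv_consistent\<close>)
  qed
qed

end

context locally_compact_group
begin

lemma locally_compact_group_subgroup:
  assumes H: "subgroup H G" and cl: "closedin T H"
  shows "locally_compact_group (G\<lparr>carrier := H\<rparr>) (subtopology T H)"
proof -
  interpret H: topological_group "G\<lparr>carrier := H\<rparr>" "subtopology T H"
    by (rule topological_group_subgroup[OF H])
  show ?thesis
  proof
    show "Hausdorff_space (subtopology T H)"
      using Hausdorff Hausdorff_space_subtopology by blast
    show "locally_compact_space (subtopology T H)"
      using locally_compact cl locally_compact_space_closed_subset by blast
  qed
qed

end

section \<open>Left Haar measures: invariance and positivity\<close>

locale haar = locally_compact_group G T for G (structure) and T :: "'a topology" +
  fixes \<mu> :: "'a measure"
  assumes left_haar: "left_haar_measure G T \<mu>"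
begin

sublocale radon T \<mu>
  using left_haar Hausdorff by unfold_locales (auto simp: left_haar_measure_def)

lemma emeasure_l_coset:
  "s \<in> carrier G \<Longrightarrow> E \<in> sets \<mu> \<Longrightarrow> emeasure \<mu> (s <# E) = emeasure \<mu> E"
  using left_haar by (auto simp: left_haar_measure_def)

lemma distr_left_translation:
  assumes "a \<in> carrier G"
  shows "distr \<mu> \<mu> (\<lambda>x. a \<otimes> x) = \<mu>"
proof (rule measure_eqI)
  fix E assume "E \<in> sets (distr \<mu> \<mu> (\<lambda>x. a \<otimes> x))"
  then have E: "E \<in> sets \<mu>" by simp
  have "(\<lambda>x. inv a \<otimes> x) ` E = inv a <# E"
    by (auto simp: l_coset_def)
  then show "emeasure (distr \<mu> \<mu> (\<lambda>x. a \<otimes> x)) E = emeasure \<mu> E"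
    using emeasure_distr_homeomorphic[OF homeomorphic_maps_left_translation[OF assms] E]
      emeasure_l_coset[of "inv a" E] assms E by simp
qed simp

lemma integral_left_translation:
  assumes a: "a \<in> carrier G" and f: "f \<in> Cc T"
  shows "(\<integral>x. f (a \<otimes> x) \<partial>\<mu>) = integral\<^sup>L \<mu> f"
  using integral_distr[OF homeomorphic_measurable[OF homeomorphic_maps_left_translation[OF a]]
      continuous_measurable[OF Cc_continuous[OF f]]]
    distr_left_translation[OF a] by simp

text \<open>Finitely many translates of \<open>U\<close> cover a given compact set, so a null
  \<open>U\<close> would make every compact set null and, by inner regularity, the whole
  space.\<close>

lemma emeasure_open_pos:
  assumes U: "openin T U" "U \<noteq> {}"
  shows "emeasure \<mu> U > 0"
proof (rule ccontr)
  assume "\<not> emeasure \<mu> U > 0"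
  then have U0: "emeasure \<mu> U = 0"
    by simp
  obtain u where u: "u \<in> U" "u \<in> carrier G"
    using U openin_subset topspace_eq by blast
  have null: "emeasure \<mu> (a <# U) = 0" if "a \<in> carrier G" for a
    using emeasure_l_coset[OF that open_sets[OF U(1)]] U0 by simp
  have "emeasure \<mu> K = 0" if K: "compactin T K" for K
  proof -
    have "K \<subseteq> \<Union>((\<lambda>x. (x \<otimes> inv u) <# U) ` K)"
    proof
      fix x assume x: "x \<in> K"
      then have "x \<in> carrier G"
        using compactin_subset_topspace[OF K] topspace_eq by auto
      then have "x = (x \<otimes> inv u) \<otimes> u"
        using u by (simp add: m_assoc)
      then have "x \<in> (x \<otimes> inv u) <# U"
        using u(1) unfolding l_coset_def by blast
      then show "x \<in> \<Union>((\<lambda>x. (x \<otimes> inv u) <# U) ` K)"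
        using x by blast
    qed
    moreover have carr: "x \<otimes> inv u \<in> carrier G" if "x \<in> K" for x
      using that compactin_subset_topspace[OF K] topspace_eq u by auto
    ultimately have "\<exists>\<F>. finite \<F> \<and> \<F> \<subseteq> (\<lambda>x. (x \<otimes> inv u) <# U) ` K \<and> K \<subseteq> \<Union>\<F>"
      using openin_l_coset[OF _ U(1)] by (intro compactinD[OF K]) auto
    then obtain D where D: "finite D" "D \<subseteq> K" "K \<subseteq> \<Union>((\<lambda>x. (x \<otimes> inv u) <# U) ` D)"
      by (metis finite_subset_image)
    have "emeasure \<mu> K \<le> emeasure \<mu> (\<Union>((\<lambda>x. (x \<otimes> inv u) <# U) ` D))"
      using D carr open_sets[OF openin_l_coset[OF _ U(1)]]
      by (intro emeasure_mono sets.finite_UN) auto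
    also have "\<dots> \<le> (\<Sum>x\<in>D. emeasure \<mu> ((x \<otimes> inv u) <# U))"
      using D carr open_sets[OF openin_l_coset[OF _ U(1)]] by (intro emeasure_subadditive_finite) auto
    also have "\<dots> = 0"
      using null carr D(2) by (intro sum.neutral) auto
    finally show ?thesis by simp
  qed
  then have "emeasure \<mu> (topspace T) = 0"
    unfolding inner_regular[OF openin_topspace] by (intro antisym SUP_least) auto
  then show False
    using left_haar by (simp add: left_haar_measure_def)
qed

text \<open>The set where \<open>f\<close> is positive is open and contains \<open>a\<close>, so it
  has positive measure and \<open>f\<close> cannot vanish almost everywhere.\<close>

lemma integral_Cc_pos:
  assumes f: "f \<in> Cc T" "\<And>x. x \<in> carrier G \<Longrightarrow> f x \<ge> 0" and a: "a \<in> carrier G" "f a > 0"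
  shows "integral\<^sup>L \<mu> f > 0"
proof -
  have nn: "AE x in \<mu>. 0 \<le> f x"
    using f(2) topspace_eq by (auto intro!: AE_I2)
  have "integral\<^sup>L \<mu> f \<noteq> 0"
  proof
    assume "integral\<^sup>L \<mu> f = 0"
    then have "AE x in \<mu>. f x = 0"
      using integral_nonneg_eq_0_iff_AE[OF Cc_integrable[OF f(1)] nn] by simp
    then have "AE x in \<mu>. x \<notin> {x \<in> topspace T. f x \<in> {0<..}}"
      by eventually_elim auto
    moreover have o: "openin T {x \<in> topspace T. f x \<in> {0<..}}"
      using openin_continuous_map_preimage[OF Cc_continuous[OF f(1)], of "{0<..}"] by simp
    ultimately have "emeasure \<mu> {x \<in> topspace T. f x \<in> {0<..}} = 0"
      using AE_iff_measurable[OF open_sets[OF o], of "\<lambda>x. x \<notin> {x \<in> topspace T. f x \<in> {0<..}}"]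
      by auto
    moreover have "{x \<in> topspace T. f x \<in> {0<..}} \<noteq> {}"
      using a topspace_eq by auto
    ultimately show False
      using emeasure_open_pos[OF o] by simp
  qed
  moreover have "integral\<^sup>L \<mu> f \<ge> 0"
    using f(2) topspace_eq by (intro Bochner_Integration.integral_nonneg) auto
  ultimately show ?thesis by simp
qed

end

section \<open>Uniqueness of Haar measure\<close>

text \<open>A cutoff: multiplying by \<open>\<psi>\<close> changes nothing near \<open>a\<close> but
  confines the variable to a compact set. It serves the continuity of orbit integrals.\<close>

lemma (in locally_compact_group) Cc_one_near_point:
  assumes a: "a \<in> carrier G"
  obtains \<psi> U where "\<psi> \<in> Cc T" "openin T U" "a \<in> U" "\<And>x. x \<in> U \<Longrightarrow> \<psi> x = (1::real)"
proof -
  obtain U K where U: "openin T U" "compactin T K" "a \<in> U" "U \<subseteq> K"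
    using locally_compact a unfolding locally_compact_space_def topspace_eq by meson
  obtain \<psi> where "\<psi> \<in> Cc T" "\<And>x. x \<in> K \<Longrightarrow> \<psi> x = (1::real)"
    using locally_compact_Hausdorff_Urysohn[OF locally_compact Hausdorff U(2) openin_topspace]
      compactin_subset_topspace[OF U(2)] by metis
  then show thesis
    using U by (intro that[of \<psi> U]) auto
qed

text \<open>With \<open>U\<close> small, \<open>\<phi>\<close> acts as an unnormalised approximate
  identity in the uniqueness proof; with \<open>U\<close> the whole space it is just a function of
  positive integral.\<close>

lemma (in locally_compact_group) Cc_bump:
  assumes U: "openin T U" "a \<in> U"
  obtains \<phi> where "\<phi> \<in> Cc T" "\<And>x. x \<in> carrier G \<Longrightarrow> 0 \<le> \<phi> x" "\<phi> a = (1::real)"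
    "\<And>x. x \<in> carrier G \<Longrightarrow> x \<notin> U \<Longrightarrow> \<phi> x = 0"
proof -
  have "compactin T {a}" "{a} \<subseteq> U"
    using U openin_subset by auto
  then obtain \<phi> where "\<phi> \<in> Cc T" "\<And>x. x \<in> topspace T \<Longrightarrow> 0 \<le> \<phi> x \<and> \<phi> x \<le> (1::real)"
      "\<And>x. x \<in> {a} \<Longrightarrow> \<phi> x = 1" "\<And>x. x \<in> topspace T \<Longrightarrow> x \<notin> U \<Longrightarrow> \<phi> x = 0"
    using locally_compact_Hausdorff_Urysohn[OF locally_compact Hausdorff _ U(1)] by metis
  then show thesis
    using that topspace_eq by auto
qed

section \<open>Averages over the orbits of a closed subgroup\<close>

locale haar_subgroup = haar G T \<mu> for G (structure) and T :: "'a topology" and \<mu> +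
  fixes N :: "'a set" and \<nu> :: "'a measure"
  assumes subgroup: "subgroup N G" and closed: "closedin T N"
    and left_haar_subgroup: "left_haar_measure (G\<lparr>carrier := N\<rparr>) (subtopology T N) \<nu>"
begin

sublocale N: haar "G\<lparr>carrier := N\<rparr>" "subtopology T N" \<nu>
  using locally_compact_group_subgroup[OF subgroup closed] left_haar_subgroup
  by (simp add: haar_def haar_axioms_def)

lemma N_subset: "n \<in> N \<Longrightarrow> n \<in> carrier G"
  using subgroup subgroup.subset by blast

lemma topspace_N [simp]: "topspace (subtopology T N) = N"
  using N_subset topspace_eq by auto

lemma N_inv: "n \<in> N \<Longrightarrow> inv n \<in> N"
  by (rule subgroup.m_inv_closed[OF subgroup])

lemma continuous_map_inclusion: "continuous_map (subtopology T N) T (\<lambda>x. x)"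
  using continuous_map_from_subtopology[OF continuous_map_id] by (simp add: id_def)

text \<open>If x lies in \<open>K\<close> and n x in \<open>L\<close>, then n lies in L K^-1. The
  trace of this compact set on the closed set \<open>N\<close> is the compact range of n to which an
  integrand \<phi>(x) f(n x) is confined.\<close>

lemma compactin_quotients:
  assumes "compactin T K" "compactin T L"
  shows "compactin (subtopology T N) (N \<inter> (\<lambda>(y, x). y \<otimes> inv x) ` (L \<times> K))"
proof -
  have "continuous_map (prod_topology T T) T (\<lambda>p. fst p \<otimes> inv (snd p))"
    by (intro continuous_map_group_mult continuous_map_group_inv continuous_map_fst continuous_map_snd)
  then have "compactin T ((\<lambda>p. fst p \<otimes> inv (snd p)) ` (L \<times> K))"
    using assms by (intro image_compactin[of "prod_topology T T"]) (auto simp: compactin_Times)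
  then have "compactin T (N \<inter> (\<lambda>p. fst p \<otimes> inv (snd p)) ` (L \<times> K))"
    using closed closed_Int_compactin by blast
  then show ?thesis
    by (auto simp: compactin_subtopology case_prod_unfold)
qed

lemma swap_integrand:
  assumes \<phi>: "\<phi> \<in> Cc T" and f: "f \<in> Cc T"
  obtains K L where "compactin T K" "compactin (subtopology T N) L"
    "\<And>x n. x \<in> carrier G \<Longrightarrow> n \<in> N \<Longrightarrow> x \<notin> K \<or> n \<notin> L \<Longrightarrow> \<phi> x * f (n \<otimes> x) = 0"
proof -
  obtain K where K: "compactin T K" "\<And>x. x \<in> topspace T \<Longrightarrow> x \<notin> K \<Longrightarrow> \<phi> x = 0"
    using CcE[OF \<phi>] by metis
  obtain L where L: "compactin T L" "\<And>x. x \<in> topspace T \<Longrightarrow> x \<notin> L \<Longrightarrow> f x = 0"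
    using CcE[OF f] by metis
  show thesis
  proof (rule that[OF K(1) compactin_quotients[OF K(1) L(1)]])
    fix x n assume x: "x \<in> carrier G" and n: "n \<in> N"
      and *: "x \<notin> K \<or> n \<notin> N \<inter> (\<lambda>(y, x). y \<otimes> inv x) ` (L \<times> K)"
    show "\<phi> x * f (n \<otimes> x) = 0"
    proof (rule ccontr)
      assume nz: "\<phi> x * f (n \<otimes> x) \<noteq> 0"
      have "x \<in> K" "n \<otimes> x \<in> L"
        using nz K(2)[of x] L(2)[of "n \<otimes> x"] x N_subset[OF n] by (auto simp: topspace_eq)
      moreover have "n = (n \<otimes> x) \<otimes> inv x"
        using x N_subset[OF n] by (simp add: m_assoc)
      ultimately have "n \<in> (\<lambda>(y, x). y \<otimes> inv x) ` (L \<times> K)"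
        by (intro image_eqI[of _ _ "(n \<otimes> x, x)"]) auto
      then show False
        using * \<open>x \<in> K\<close> n by blast
    qed
  qed
qed

lemma continuous_map_swap_integrand:
  assumes \<phi>: "\<phi> \<in> Cc T" and f: "f \<in> Cc T"
  shows "continuous_map (prod_topology T (subtopology T N)) euclideanreal (\<lambda>(x, n). \<phi> x * f (n \<otimes> x))"
proof -
  have s: "continuous_map (prod_topology T (subtopology T N)) T snd"
    using continuous_map_compose[OF continuous_map_snd continuous_map_inclusion] by (simp add: o_def)
  have "continuous_map (prod_topology T (subtopology T N)) euclideanreal (\<phi> \<circ> fst)"
    by (rule continuous_map_compose[OF continuous_map_fst Cc_continuous[OF \<phi>]])
  moreover have "continuous_map (prod_topology T (subtopology T N)) euclideanreal
      (f \<circ> (\<lambda>p. snd p \<otimes> fst p))"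
    by (rule continuous_map_compose[OF continuous_map_group_mult[OF s continuous_map_fst]
          Cc_continuous[OF f]])
  ultimately show ?thesis
    by (simp add: case_prod_unfold o_def continuous_map_real_mult)
qed

text \<open>As x runs through the group, no single compact set of n need carry f(n x). Continuity is
  local, however: near \<open>x0\<close> the cutoff \<open>\<psi>\<close> equals 1, and \<psi>(x)
  f(n x) does vanish off one compact set of n.\<close>

lemma continuous_map_orbit_integral:
  assumes f: "f \<in> Cc T"
  shows "continuous_map T euclideanreal (\<lambda>x. \<integral>n. f (n \<otimes> x) \<partial>\<nu>)"
  unfolding continuous_map_real_iff
proof (intro ballI allI impI)
  fix x0 and e :: real assume x0: "x0 \<in> topspace T" and e: "e > 0"
  obtain \<psi> U where U: "\<psi> \<in> Cc T" "openin T U" "x0 \<in> U" "\<And>x. x \<in> U \<Longrightarrow> \<psi> x = 1"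
    using Cc_one_near_point x0 topspace_eq by metis
  obtain K L where "compactin (subtopology T N) L"
    "\<And>x n. x \<in> carrier G \<Longrightarrow> n \<in> N \<Longrightarrow> x \<notin> K \<or> n \<notin> L \<Longrightarrow> \<psi> x * f (n \<otimes> x) = 0"
    using swap_integrand[OF U(1) f] by metis
  then have "continuous_map T euclideanreal (\<lambda>x. \<integral>n. \<psi> x * f (n \<otimes> x) \<partial>\<nu>)"
    using topspace_eq
    by (intro N.continuous_map_parameter_integral(3)[OF continuous_map_swap_integrand[OF U(1) f]]) auto
  then obtain V where V: "openin T V" "x0 \<in> V"
    "\<forall>x\<in>V. \<bar>(\<integral>n. \<psi> x * f (n \<otimes> x) \<partial>\<nu>) - (\<integral>n. \<psi> x0 * f (n \<otimes> x0) \<partial>\<nu>)\<bar> < e"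
    using x0 e unfolding continuous_map_real_iff by meson
  show "\<exists>U. openin T U \<and> x0 \<in> U \<and>
     (\<forall>x\<in>U. \<bar>(\<integral>n. f (n \<otimes> x) \<partial>\<nu>) - (\<integral>n. f (n \<otimes> x0) \<partial>\<nu>)\<bar> < e)"
    using U V by (intro exI[of _ "U \<inter> V"]) auto
qed

text \<open>
  No modular function enters: the swap only uses left invariance, because the inner integral
  runs over the left factor.
\<close>

lemma orbit_integral_swap:
  assumes \<phi>: "\<phi> \<in> Cc T" and f: "f \<in> Cc T"
  shows "(\<integral>x. \<phi> x * (\<integral>n. f (n \<otimes> x) \<partial>\<nu>) \<partial>\<mu>) = (\<integral>x. f x * (\<integral>n. \<phi> (inv n \<otimes> x) \<partial>\<nu>) \<partial>\<mu>)"
proof -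
  have fub: "(\<integral>x. (\<integral>n. \<phi> x * f (n \<otimes> x) \<partial>\<nu>) \<partial>\<mu>) = (\<integral>n. (\<integral>x. \<phi> x * f (n \<otimes> x) \<partial>\<mu>) \<partial>\<nu>)"
  proof -
    obtain K L where KL: "compactin T K" "compactin (subtopology T N) L"
      "\<And>x n. x \<in> carrier G \<Longrightarrow> n \<in> N \<Longrightarrow> x \<notin> K \<or> n \<notin> L \<Longrightarrow> \<phi> x * f (n \<otimes> x) = 0"
      using swap_integrand[OF \<phi> f] by metis
    show ?thesis
      by (rule Cc_Fubini[OF radon_axioms N.radon_axioms continuous_map_swap_integrand[OF \<phi> f] KL(1,2)])
        (use KL(3) topspace_eq in auto)
  qed
  have fub': "(\<integral>x. (\<integral>n. f x * \<phi> (inv n \<otimes> x) \<partial>\<nu>) \<partial>\<mu>) = (\<integral>n. (\<integral>x. f x * \<phi> (inv n \<otimes> x) \<partial>\<mu>) \<partial>\<nu>)"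
  proof -
    obtain K L where KL: "compactin T K" "compactin (subtopology T N) L"
      "\<And>x n. x \<in> carrier G \<Longrightarrow> n \<in> N \<Longrightarrow> x \<notin> K \<or> n \<notin> L \<Longrightarrow> f x * \<phi> (n \<otimes> x) = 0"
      using swap_integrand[OF f \<phi>] by metis
    \<comment> \<open>The integrand is one of the kind already treated, with n inverted, so its
      compact set of n is the inverse of \<open>L\<close>.\<close>
    let ?j = "\<lambda>n. inv n"
    have j: "continuous_map (subtopology T N) (subtopology T N) ?j"
      using continuous_map_group_inv[OF continuous_map_inclusion] N_inv
      by (auto simp: continuous_map_in_subtopology)
    have "continuous_map (prod_topology T (subtopology T N)) (prod_topology T (subtopology T N))
        (\<lambda>p. (fst p, ?j (snd p)))"
      using continuous_map_compose[OF continuous_map_snd j]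
      by (intro continuous_map_pairedI continuous_map_fst) (simp add: o_def)
    from continuous_map_compose[OF this continuous_map_swap_integrand[OF f \<phi>]]
    have c: "continuous_map (prod_topology T (subtopology T N)) euclideanreal
        (\<lambda>(x, n). f x * \<phi> (inv n \<otimes> x))"
      by (simp add: o_def case_prod_unfold)
    have L': "compactin (subtopology T N) (?j ` L)"
      by (rule image_compactin[OF KL(2) j])
    show ?thesis
    proof (rule Cc_Fubini[OF radon_axioms N.radon_axioms c KL(1) L'])
      fix x n assume x: "x \<in> topspace T" "n \<in> topspace (subtopology T N)" "x \<notin> K \<or> n \<notin> ?j ` L"
      have "n = inv (inv n)"
        using x N_subset by simp
      then have "x \<notin> K \<or> inv n \<notin> L"
        using x(3) by blast
      then show "f x * \<phi> (inv n \<otimes> x) = 0"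
        using KL(3)[of x "inv n"] x N_inv topspace_eq by auto
    qed
  qed
  \<comment> \<open>Substituting n x for x moves n from one factor to the other.\<close>
  have inner: "(\<integral>x. \<phi> x * f (n \<otimes> x) \<partial>\<mu>) = (\<integral>x. f x * \<phi> (inv n \<otimes> x) \<partial>\<mu>)" if n: "n \<in> N" for n
  proof -
    have nG: "n \<in> carrier G" "inv n \<in> carrier G"
      using N_subset n by auto
    have "(\<lambda>x. f x * \<phi> (inv n \<otimes> x)) \<in> Cc T"
      by (intro Cc_mult f Cc_continuous[OF Cc_homeomorphic_compose[OF homeomorphic_maps_left_translation[OF nG(2)] \<phi>]])
    from integral_left_translation[OF nG(1) this]
    have "(\<integral>x. f x * \<phi> (inv n \<otimes> x) \<partial>\<mu>) = (\<integral>x. f (n \<otimes> x) * \<phi> (inv n \<otimes> (n \<otimes> x)) \<partial>\<mu>)"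
      by simp
    also have "\<dots> = (\<integral>x. \<phi> x * f (n \<otimes> x) \<partial>\<mu>)"
      using nG by (intro Bochner_Integration.integral_cong) (auto simp: topspace_eq m_assoc[symmetric])
    finally show ?thesis by simp
  qed
  have "(\<integral>n. (\<integral>x. \<phi> x * f (n \<otimes> x) \<partial>\<mu>) \<partial>\<nu>) = (\<integral>n. (\<integral>x. f x * \<phi> (inv n \<otimes> x) \<partial>\<mu>) \<partial>\<nu>)"
    by (rule Bochner_Integration.integral_cong) (auto simp: inner)
  then show ?thesis
    using fub fub' by simp
qed

end

section \<open>Two left Haar measures are proportional\<close>

context haar
begin

lemma positive_Cc_exists:
  obtains f where "f \<in> Cc T" "\<And>x. x \<in> carrier G \<Longrightarrow> 0 \<le> f x" "f \<one> = (1::real)"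
  using Cc_bump[OF openin_topspace, of \<one>] topspace_eq by auto

text \<open>For a bump \<open>\<phi>\<close> near the identity, the swap turns \<open>C\<close>
  times the \<mu>-integral of \<open>h\<close> into the \<mu>-integral of \<phi>(x) times the orbit
  integral of \<open>h\<close> at x. By continuity of the latter this is nearly \<open>M\<close>
  times the \<nu>-integral of \<open>h\<close>. The ratio \<open>C / M\<close> depends on
  \<open>\<phi>\<close> but not on \<open>h\<close>; comparison with one fixed \<open>f0\<close>
  eliminates it.\<close>

lemma left_haar_integral_proportional:
  assumes \<nu>: "left_haar_measure G T \<nu>"
  obtains c where "c > 0" "\<And>f. f \<in> Cc T \<Longrightarrow> integral\<^sup>L \<nu> f = c * integral\<^sup>L \<mu> f"
proof -
  have "subgroup (carrier G) G" "closedin T (carrier G)"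
    using subgroup_self topspace_eq closedin_topspace by metis+
  moreover have "subtopology T (carrier G) = T"
    using topspace_eq subtopology_topspace by metis
  \<comment> \<open>The subgroup is the whole group and carries the second measure: x is integrated
    against \<open>\<mu>\<close> and n against \<open>\<nu>\<close>.\<close>
  ultimately interpret p: haar_subgroup G T \<mu> "carrier G" \<nu>
    using \<nu> by unfold_locales auto
  interpret \<nu>: haar G T \<nu>
    using \<nu> by unfold_locales
  \<comment> \<open>One \<open>r\<close> has to serve \<open>f\<close> and \<open>g\<close> at once,
    so \<open>\<phi>\<close> is concentrated where both orbit integrals are close to their values at
    the identity.\<close>
  have approx: "\<exists>r>0. \<bar>r * integral\<^sup>L \<mu> f - integral\<^sup>L \<nu> f\<bar> \<le> e \<and> \<bar>r * integral\<^sup>L \<mu> g - integral\<^sup>L \<nu> g\<bar> \<le> e"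
    if f: "f \<in> Cc T" and g: "g \<in> Cc T" and e: "e > 0" for f g e
  proof -
    have orbit_one: "(\<integral>n. h (n \<otimes> \<one>) \<partial>\<nu>) = integral\<^sup>L \<nu> h" for h :: "'a \<Rightarrow> real"
      by (intro Bochner_Integration.integral_cong) (auto simp: topspace_eq)
    have near: "\<exists>U. openin T U \<and> \<one> \<in> U \<and> (\<forall>x\<in>U. \<bar>(\<integral>n. h (n \<otimes> x) \<partial>\<nu>) - integral\<^sup>L \<nu> h\<bar> < e)"
      if "h \<in> Cc T" for h
      using p.continuous_map_orbit_integral[OF that] e topspace_eq unfolding continuous_map_real_iff
      by (metis orbit_one one_closed)
    obtain U V where U: "openin T U" "\<one> \<in> U" "\<forall>x\<in>U. \<bar>(\<integral>n. f (n \<otimes> x) \<partial>\<nu>) - integral\<^sup>L \<nu> f\<bar> < e"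
      and V: "openin T V" "\<one> \<in> V" "\<forall>x\<in>V. \<bar>(\<integral>n. g (n \<otimes> x) \<partial>\<nu>) - integral\<^sup>L \<nu> g\<bar> < e"
      using near[OF f] near[OF g] by metis
    obtain \<phi> where \<phi>: "\<phi> \<in> Cc T" "\<And>x. x \<in> carrier G \<Longrightarrow> 0 \<le> \<phi> x" "\<phi> \<one> = (1::real)"
      "\<And>x. x \<in> carrier G \<Longrightarrow> x \<notin> U \<inter> V \<Longrightarrow> \<phi> x = 0"
      using Cc_bump[of "U \<inter> V" \<one>] U V openin_Int by auto
    define M where "M = integral\<^sup>L \<mu> \<phi>"
    define C where "C = (\<integral>n. \<phi> (inv n) \<partial>\<nu>)"
    have Mpos: "M > 0"
      unfolding M_def using integral_Cc_pos[OF \<phi>(1,2), of \<one>] \<phi>(3) by simp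
    have \<phi>inv: "(\<lambda>n. \<phi> (inv n)) \<in> Cc T"
      using Cc_homeomorphic_compose[OF homeomorphic_maps_inv \<phi>(1)] .
    have Cpos: "C > 0"
      unfolding C_def using \<nu>.integral_Cc_pos[OF \<phi>inv, of \<one>] \<phi>(2,3) by simp
    \<comment> \<open>Replacing n by x n turns \<phi>(n^-1 x) into \<phi>(n^-1), so the average does
      not depend on x.\<close>
    have const: "(\<integral>n. \<phi> (inv n \<otimes> x) \<partial>\<nu>) = C" if x: "x \<in> carrier G" for x
    proof -
      have hh: "(\<lambda>n. \<phi> (inv n \<otimes> x)) \<in> Cc T"
        using Cc_homeomorphic_compose[OF homeomorphic_maps_inv
            Cc_homeomorphic_compose[OF homeomorphic_maps_right_translation[OF x] \<phi>(1)]] .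
      have "C = (\<integral>n. \<phi> (inv (x \<otimes> n) \<otimes> x) \<partial>\<nu>)"
        unfolding C_def using x
        by (intro Bochner_Integration.integral_cong) (auto simp: topspace_eq inv_mult_group m_assoc)
      then show ?thesis
        using \<nu>.integral_left_translation[OF x hh] by simp
    qed
    have est: "\<bar>C / M * integral\<^sup>L \<mu> h - integral\<^sup>L \<nu> h\<bar> \<le> e"
      if h: "h \<in> Cc T" and hU: "\<And>x. x \<in> U \<inter> V \<Longrightarrow> \<bar>(\<integral>n. h (n \<otimes> x) \<partial>\<nu>) - integral\<^sup>L \<nu> h\<bar> < e" for h
    proof -
      have i: "integrable \<mu> (\<lambda>x. \<phi> x * (\<integral>n. h (n \<otimes> x) \<partial>\<nu>))"
        by (intro Cc_integrable Cc_mult[OF \<phi>(1)] p.continuous_map_orbit_integral h)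
      have i\<phi>: "integrable \<mu> \<phi>"
        by (rule Cc_integrable[OF \<phi>(1)])
      have "C * integral\<^sup>L \<mu> h = (\<integral>x. h x * (\<integral>n. \<phi> (inv n \<otimes> x) \<partial>\<nu>) \<partial>\<mu>)"
      proof -
        have "(\<integral>x. h x * (\<integral>n. \<phi> (inv n \<otimes> x) \<partial>\<nu>) \<partial>\<mu>) = (\<integral>x. h x * C \<partial>\<mu>)"
          by (intro Bochner_Integration.integral_cong) (auto simp: const topspace_eq)
        then show ?thesis by simp
      qed
      also have "\<dots> = (\<integral>x. \<phi> x * (\<integral>n. h (n \<otimes> x) \<partial>\<nu>) \<partial>\<mu>)"
        by (rule p.orbit_integral_swap[OF \<phi>(1) h, symmetric])
      finally have "C * integral\<^sup>L \<mu> h - M * integral\<^sup>L \<nu> h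
          = (\<integral>x. \<phi> x * (\<integral>n. h (n \<otimes> x) \<partial>\<nu>) - \<phi> x * integral\<^sup>L \<nu> h \<partial>\<mu>)"
        unfolding M_def using i i\<phi> by simp
      also have "\<bar>\<dots>\<bar> \<le> (\<integral>x. \<bar>\<phi> x * (\<integral>n. h (n \<otimes> x) \<partial>\<nu>) - \<phi> x * integral\<^sup>L \<nu> h\<bar> \<partial>\<mu>)"
        by (rule integral_abs_bound)
      also have "\<dots> \<le> (\<integral>x. \<phi> x * e \<partial>\<mu>)"
      proof (intro integral_mono)
        fix x assume "x \<in> space \<mu>"
        then have x: "x \<in> carrier G" using topspace_eq by simp
        show "\<bar>\<phi> x * (\<integral>n. h (n \<otimes> x) \<partial>\<nu>) - \<phi> x * integral\<^sup>L \<nu> h\<bar> \<le> \<phi> x * e"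
        proof (cases "x \<in> U \<inter> V")
          case True
          have "\<phi> x * \<bar>(\<integral>n. h (n \<otimes> x) \<partial>\<nu>) - integral\<^sup>L \<nu> h\<bar> \<le> \<phi> x * e"
            using hU[OF True] \<phi>(2)[OF x] by (intro mult_left_mono) auto
          then show ?thesis
            using \<phi>(2)[OF x] by (simp add: abs_mult right_diff_distrib[symmetric])
        qed (use \<phi>(4)[OF x] in simp)
      qed (use i i\<phi> in auto)
      also have "\<dots> = M * e"
        by (simp add: M_def)
      finally have "\<bar>C * integral\<^sup>L \<mu> h - M * integral\<^sup>L \<nu> h\<bar> \<le> M * e" .
      moreover have "C * integral\<^sup>L \<mu> h - M * integral\<^sup>L \<nu> h = M * (C / M * integral\<^sup>L \<mu> h - integral\<^sup>L \<nu> h)"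
        using Mpos by (simp add: field_simps)
      ultimately show ?thesis
        using Mpos by (simp add: abs_mult)
    qed
    show ?thesis
      using est[OF f] est[OF g] U(3) V(3) Mpos Cpos by (intro exI[of _ "C / M"]) auto
  qed
  obtain f0 where f0: "f0 \<in> Cc T" "\<And>x. x \<in> carrier G \<Longrightarrow> 0 \<le> f0 x" "f0 \<one> = (1::real)"
    using positive_Cc_exists by metis
  define I where "I = integral\<^sup>L \<mu> f0"
  define J where "J = integral\<^sup>L \<nu> f0"
  have pos: "I > 0" "J > 0"
    unfolding I_def J_def using integral_Cc_pos[OF f0(1,2), of \<one>] \<nu>.integral_Cc_pos[OF f0(1,2), of \<one>] f0(3)
    by auto
  have eq: "integral\<^sup>L \<nu> g = J / I * integral\<^sup>L \<mu> g" if g: "g \<in> Cc T" for g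
  proof -
    define a where "a = integral\<^sup>L \<mu> g"
    define b where "b = integral\<^sup>L \<nu> g"
    have bound: "\<bar>b * I - J * a\<bar> \<le> 0 + e" if e: "e > 0" for e
    proof -
      \<comment> \<open>Chosen so that the two errors below, \<open>d * \<bar>a\<bar>\<close> and
        \<open>d * I\<close>, add up to \<open>e\<close>.\<close>
      define d where "d = e / (I + \<bar>a\<bar>)"
      have d: "d > 0"
        using e pos by (simp add: d_def add_pos_nonneg)
      obtain r where r: "\<bar>r * I - J\<bar> \<le> d" "\<bar>r * a - b\<bar> \<le> d"
        using approx[OF f0(1) g d] unfolding I_def J_def a_def b_def by blast
      \<comment> \<open>The factor \<open>r\<close> varies with \<open>e\<close>; this combination
        cancels it.\<close>
      have "b * I - J * a = (r * I - J) * a - (r * a - b) * I"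
        by (simp add: algebra_simps)
      also have "\<bar>\<dots>\<bar> \<le> \<bar>r * I - J\<bar> * \<bar>a\<bar> + \<bar>r * a - b\<bar> * I"
        using pos abs_triangle_ineq4[of "(r * I - J) * a" "(r * a - b) * I"] by (simp add: abs_mult)
      also have "\<dots> \<le> d * \<bar>a\<bar> + d * I"
        using r pos by (intro add_mono mult_right_mono) auto
      also have "\<dots> = d * (I + \<bar>a\<bar>)"
        by (simp add: algebra_simps)
      also have "\<dots> = e"
        using pos by (simp add: d_def add_pos_nonneg less_imp_neq[symmetric])
      finally show ?thesis by simp
    qed
    have "\<bar>b * I - J * a\<bar> \<le> 0"
      using bound by (rule field_le_epsilon)
    then show ?thesis
      using pos unfolding a_def b_def by (simp add: field_simps)
  qed
  then show thesis
    using that[of "J / I"] pos by simp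
qed

theorem left_haar_measure_unique:
  assumes \<nu>: "left_haar_measure G T \<nu>"
  obtains c where "c > 0" "\<And>E. E \<in> sets \<mu> \<Longrightarrow> emeasure \<nu> E = ennreal c * emeasure \<mu> E"
proof -
  interpret \<nu>: haar G T \<nu>
    using \<nu> by unfold_locales
  obtain c where "c > 0" "\<And>f. f \<in> Cc T \<Longrightarrow> integral\<^sup>L \<nu> f = c * integral\<^sup>L \<mu> f"
    using left_haar_integral_proportional[OF \<nu>] by metis
  then show thesis
    using that radon_eq_of_Cc_integral[OF radon_axioms \<nu>.radon_axioms locally_compact] by metis
qed

end

section \<open>Existence of Haar measure\<close>

locale content =
  fixes T :: "'a topology" and l :: "'a set \<Rightarrow> real"
  assumes Hausdorff: "Hausdorff_space T"
    and locally_compact: "locally_compact_space T"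
    and nonneg: "compactin T K \<Longrightarrow> 0 \<le> l K"
    and mono: "compactin T K \<Longrightarrow> compactin T L \<Longrightarrow> K \<subseteq> L \<Longrightarrow> l K \<le> l L"
    and subadditive: "compactin T K \<Longrightarrow> compactin T L \<Longrightarrow> l (K \<union> L) \<le> l K + l L"
    and additive: "compactin T K \<Longrightarrow> compactin T L \<Longrightarrow> disjnt K L \<Longrightarrow> l (K \<union> L) = l K + l L"
begin

lemma empty: "l {} = 0"
  using additive[of "{}" "{}"] by simp

definition inner :: "'a set \<Rightarrow> ennreal" where
  "inner U = (SUP K\<in>{K. compactin T K \<and> K \<subseteq> U}. ennreal (l K))"

definition outer :: "'a set \<Rightarrow> ennreal" where
  "outer E = (INF U\<in>{U. openin T U \<and> E \<subseteq> U}. inner U)"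

lemma inner_upper: "compactin T K \<Longrightarrow> K \<subseteq> U \<Longrightarrow> ennreal (l K) \<le> inner U"
  unfolding inner_def by (rule SUP_upper) auto

lemma inner_mono: "U \<subseteq> V \<Longrightarrow> inner U \<le> inner V"
  unfolding inner_def by (rule SUP_subset_mono) auto

lemma outer_lower: "openin T U \<Longrightarrow> E \<subseteq> U \<Longrightarrow> outer E \<le> inner U"
  unfolding outer_def by (rule INF_lower) auto

lemma outer_mono: "E \<subseteq> F \<Longrightarrow> outer E \<le> outer F"
  unfolding outer_def by (rule INF_superset_mono) auto

lemma outer_open: "openin T U \<Longrightarrow> outer U = inner U"
  unfolding outer_def by (intro antisym INF_greatest INF_lower) (auto intro: inner_mono)

text \<open>Equality may fail, since a content need not be the infimum of its values on compact
  neighbourhoods. The inequality is enough for inner regularity of the resulting measure.\<close>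

lemma le_outer_compact: "compactin T K \<Longrightarrow> ennreal (l K) \<le> outer K"
  unfolding outer_def by (rule INF_greatest) (auto intro: inner_upper)

text \<open>Source of finiteness on compact sets: the content of a compact neighbourhood is a real
  number that bounds \<open>inner U\<close>.\<close>

lemma outer_le_compact:
  assumes "E \<subseteq> U" "U \<subseteq> L" "openin T U" "compactin T L"
  shows "outer E \<le> ennreal (l L)"
proof -
  have "outer E \<le> inner U"
    using assms outer_lower by blast
  also have "\<dots> \<le> ennreal (l L)"
    unfolding inner_def using assms mono nonneg by (intro SUP_least) (auto intro!: ennreal_leI)
  finally show ?thesis .
qed

text \<open>A compact set covered by two open sets splits into compact pieces inside each, so
  subadditivity of \<open>l\<close> for two sets iterates.\<close>

lemma finite_union_le_inner:
  assumes "\<And>i::nat. openin T (U i)"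
  shows "compactin T K \<Longrightarrow> K \<subseteq> (\<Union>i<n. U i) \<Longrightarrow> ennreal (l K) \<le> (\<Sum>i<n. inner (U i))"
proof (induction n arbitrary: K)
  case 0
  then show ?case using empty by simp
next
  case (Suc n)
  have "K \<subseteq> (\<Union>i<n. U i) \<union> U n"
    using Suc.prems by (auto simp: lessThan_Suc)
  moreover have "openin T (\<Union>i<n. U i)"
    using assms by auto
  ultimately obtain A B where AB: "compactin T A" "compactin T B" "A \<subseteq> (\<Union>i<n. U i)" "B \<subseteq> U n" "K = A \<union> B"
    using compactin_Un_split[OF Hausdorff Suc.prems(1) _ assms] by metis
  have "ennreal (l K) \<le> ennreal (l A + l B)"
    using subadditive AB by (intro ennreal_leI) auto
  also have "\<dots> = ennreal (l A) + ennreal (l B)"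
    using nonneg AB by (intro ennreal_plus) auto
  also have "\<dots> \<le> (\<Sum>i<n. inner (U i)) + inner (U n)"
    using Suc.IH AB by (intro add_mono inner_upper) auto
  finally show ?case by simp
qed

lemma inner_UN_le:
  assumes "\<And>i::nat. openin T (U i)"
  shows "inner (\<Union>i. U i) \<le> (\<Sum>i. inner (U i))"
  unfolding inner_def[of "\<Union>i. U i"]
proof (rule SUP_least)
  fix K assume "K \<in> {K. compactin T K \<and> K \<subseteq> (\<Union>i. U i)}"
  then have K: "compactin T K" "K \<subseteq> (\<Union>i. U i)" by auto
  have "\<exists>\<F>. finite \<F> \<and> \<F> \<subseteq> range U \<and> K \<subseteq> \<Union>\<F>"
    using K assms by (intro compactinD[OF K(1)]) auto
  then obtain D where D: "finite D" "K \<subseteq> \<Union>(U ` D)"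
    by (metis finite_subset_image)
  then obtain n where "D \<subseteq> {..<n}"
    using finite_nat_iff_bounded by blast
  then have "K \<subseteq> (\<Union>i<n. U i)"
    using D by blast
  then have "ennreal (l K) \<le> (\<Sum>i<n. inner (U i))"
    by (rule finite_union_le_inner[OF assms K(1)])
  also have "\<dots> \<le> (\<Sum>i. inner (U i))"
    by (rule sum_le_suminf) auto
  finally show "ennreal (l K) \<le> (\<Sum>i. inner (U i))" .
qed

lemma outer_UN_le:
  fixes A :: "nat \<Rightarrow> 'a set"
  assumes A: "\<And>i. A i \<subseteq> topspace T"
  shows "outer (\<Union>i. A i) \<le> (\<Sum>i. outer (A i))"
proof (rule ennreal_le_epsilon)
  fix e :: real assume e: "0 < e"
  \<comment> \<open>The exponents start at \<open>Suc i\<close> so that the weights sum to 1 and the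
    total excess is \<open>e\<close>. An excess gives strict room only above a finite value; if
    \<open>outer (A i)\<close> is infinite, the whole space serves.\<close>
  have "\<exists>U. openin T U \<and> A i \<subseteq> U \<and> inner U \<le> outer (A i) + ennreal e * ennreal ((1/2) ^ Suc i)" for i
  proof (cases "outer (A i) = \<infinity>")
    case True
    then show ?thesis
      using A[of i] by (intro exI[of _ "topspace T"]) auto
  next
    case False
    have "ennreal e * ennreal ((1/2) ^ Suc i) > 0"
      using e by (simp add: ennreal_zero_less_mult_iff)
    then have "outer (A i) < outer (A i) + ennreal e * ennreal ((1/2) ^ Suc i)"
      using False by (simp add: ennreal_add_left_cancel_less top.not_eq_extremum)
    then show ?thesis
      unfolding outer_def[of "A i"] INF_less_iff by (auto intro: less_imp_le)
  qed
  then obtain U where U: "\<And>i. openin T (U i)" "\<And>i. A i \<subseteq> U i"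
    "\<And>i. inner (U i) \<le> outer (A i) + ennreal e * ennreal ((1/2) ^ Suc i)"
    by metis
  have "outer (\<Union>i. A i) \<le> inner (\<Union>i. U i)"
    using U by (intro outer_lower) auto
  also have "\<dots> \<le> (\<Sum>i. inner (U i))"
    by (rule inner_UN_le[OF U(1)])
  also have "\<dots> \<le> (\<Sum>i. outer (A i) + ennreal e * ennreal ((1/2) ^ Suc i))"
    using U by (intro suminf_le) auto
  also have "\<dots> = (\<Sum>i. outer (A i)) + (\<Sum>i. ennreal e * ennreal ((1/2) ^ Suc i))"
    by (rule suminf_add[symmetric]) auto
  also have "(\<Sum>i. ennreal e * ennreal ((1/2) ^ Suc i)) = ennreal e"
    unfolding ennreal_suminf_cmult
    by (subst suminf_ennreal_eq[OF zero_le_power power_half_series]) auto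
  finally show "outer (\<Union>i. A i) \<le> (\<Sum>i. outer (A i)) + ennreal e" .
qed

lemma outer_Un_le:
  assumes "A \<subseteq> topspace T" "B \<subseteq> topspace T"
  shows "outer (A \<union> B) \<le> outer A + outer B"
proof -
  have e: "outer {} = 0"
    using outer_open[of "{}"] empty by (auto simp: inner_def)
  define C where "C i = (if i = 0 then A else if i = 1 then B else {})" for i :: nat
  have "(\<Union>i. C i) = A \<union> B"
    by (auto simp: C_def split: if_splits)
  then have "outer (A \<union> B) \<le> (\<Sum>i. outer (C i))"
    using outer_UN_le[of C] assms by (auto simp: C_def split: if_splits)
  also have "\<dots> = (\<Sum>i\<in>{0,1}. outer (C i))"
    by (rule suminf_finite) (auto simp: C_def e)
  also have "\<dots> = outer A + outer B"
    by (simp add: C_def)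
  finally show ?thesis .
qed

text \<open>Caratheodory's condition for open \<open>U\<close>. Exhaust \<open>W \<inter> U\<close>
  by compact \<open>K\<close>; then \<open>W - K\<close> is open around \<open>E - U\<close>, and a
  compact \<open>L\<close> inside it is disjoint from \<open>K\<close>, so additivity gives
  \<open>l K + l L \<le> inner W\<close> up to the embedding into \<open>ennreal\<close>. Suprema
  over \<open>L\<close> and then \<open>K\<close> yield one inequality, subadditivity the
  other.\<close>

lemma outer_open_split:
  assumes U: "openin T U" and E: "E \<subseteq> topspace T"
  shows "outer (E \<inter> U) + outer (E - U) = outer E"
proof (rule antisym)
  show "outer (E \<inter> U) + outer (E - U) \<le> outer E"
    unfolding outer_def[of E]
  proof (rule INF_greatest)
    fix W assume "W \<in> {W. openin T W \<and> E \<subseteq> W}"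
    then have W: "openin T W" "E \<subseteq> W" by auto
    have *: "ennreal (l K) + outer (E - U) \<le> inner W" if K: "compactin T K" "K \<subseteq> W \<inter> U" for K
    proof -
      have "openin T (W - K)"
        using W K compactin_imp_closedin[OF Hausdorff] openin_diff by blast
      then have "outer (E - U) \<le> inner (W - K)"
        using W K by (intro outer_lower) auto
      then have "ennreal (l K) + outer (E - U) \<le> ennreal (l K) + inner (W - K)"
        by (rule add_left_mono)
      also have "\<dots> = (SUP L\<in>{L. compactin T L \<and> L \<subseteq> W - K}. ennreal (l K) + ennreal (l L))"
        unfolding inner_def by (rule ennreal_SUP_add_right) auto
      also have "\<dots> \<le> inner W"
      proof (rule SUP_least)
        fix L assume "L \<in> {L. compactin T L \<and> L \<subseteq> W - K}"
        then have L: "compactin T L" "L \<subseteq> W - K" by auto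
        have "ennreal (l K) + ennreal (l L) = ennreal (l (K \<union> L))"
        proof -
          have "disjnt K L"
            using L by (auto simp: disjnt_iff)
          then show ?thesis
            using K L additive nonneg by (simp add: ennreal_plus)
        qed
        also have "\<dots> \<le> inner W"
          using K L by (intro inner_upper compactin_Un) auto
        finally show "ennreal (l K) + ennreal (l L) \<le> inner W" .
      qed
      finally show ?thesis .
    qed
    have "outer (E \<inter> U) + outer (E - U) \<le> inner (W \<inter> U) + outer (E - U)"
      using U W by (intro add_right_mono outer_lower) auto
    also have "\<dots> = (SUP K\<in>{K. compactin T K \<and> K \<subseteq> W \<inter> U}. ennreal (l K) + outer (E - U))"
      unfolding inner_def by (rule ennreal_SUP_add_left[symmetric]) auto
    also have "\<dots> \<le> inner W"
      by (rule SUP_least) (use * in auto)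
    finally show "outer (E \<inter> U) + outer (E - U) \<le> inner W" .
  qed
  have "E = (E \<inter> U) \<union> (E - U)" by auto
  then show "outer E \<le> outer (E \<inter> U) + outer (E - U)"
    using outer_Un_le[of "E \<inter> U" "E - U"] E by auto
qed

text \<open>Caratheodory's construction for \<open>outer\<close>: its lambda system contains the
  open sets, hence the Borel sets. Outer regularity is then the definition of \<open>outer\<close>,
  and inner regularity on open sets follows from \<open>le_outer_compact\<close>.\<close>

theorem radon_measure_of_content:
  obtains \<mu> where "radon_measure T \<mu>" "\<And>U. openin T U \<Longrightarrow> emeasure \<mu> U = inner U"
proof -
  let ?\<Omega> = "topspace T"
  let ?L = "lambda_system ?\<Omega> (Pow ?\<Omega>) outer"
  interpret P: sigma_algebra ?\<Omega> "Pow ?\<Omega>"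
    by (rule sigma_algebra_Pow)
  have e: "outer {} = 0"
    using outer_open[of "{}"] empty by (auto simp: inner_def)
  have "outer_measure_space (Pow ?\<Omega>) outer"
    unfolding outer_measure_space_def
  proof (intro conjI)
    show "positive (Pow ?\<Omega>) outer"
      using e by (simp add: positive_def)
    show "increasing (Pow ?\<Omega>) outer"
      using outer_mono by (simp add: increasing_def)
    show "countably_subadditive (Pow ?\<Omega>) outer"
      unfolding countably_subadditive_def using outer_UN_le by auto
  qed
  then have ms: "measure_space ?\<Omega> ?L outer"
    by (rule P.caratheodory_lemma)
  have "{U. openin T U} \<subseteq> ?L"
    unfolding P.lambda_system_eq using openin_subset outer_open_split by auto
  then have sub: "borel_sigma T \<subseteq> ?L"
    using ms unfolding borel_sigma_def measure_space_def
    by (intro sigma_algebra.sigma_sets_subset) auto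
  define \<mu> where "\<mu> = measure_of ?\<Omega> {U. openin T U} outer"
  have opens: "{U. openin T U} \<subseteq> Pow ?\<Omega>"
    using openin_subset by auto
  have sets: "sets \<mu> = borel_sigma T"
    unfolding \<mu>_def borel_sigma_def using opens by simp
  have em: "emeasure \<mu> E = outer E" if "E \<in> borel_sigma T" for E
  proof (rule emeasure_measure_of[OF \<mu>_def opens])
    show "positive (sets \<mu>) outer"
      using e by (simp add: positive_def)
    show "countably_additive (sets \<mu>) outer"
      using ms sub unfolding sets measure_space_def countably_additive_def
      by (meson order_trans subsetD)
    show "E \<in> sets \<mu>"
      using that sets by simp
  qed
  have ob: "U \<in> borel_sigma T" if "openin T U" for U
    using that unfolding borel_sigma_def by (auto intro: sigma_sets.Basic)
  have cb: "K \<in> borel_sigma T" if "compactin T K" for K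
  proof -
    have "closedin T K"
      using that compactin_imp_closedin Hausdorff by blast
    then have "?\<Omega> - K \<in> borel_sigma T"
      by (intro ob) auto
    then have "?\<Omega> - (?\<Omega> - K) \<in> borel_sigma T"
      unfolding borel_sigma_def by (rule sigma_sets.Compl)
    then show ?thesis
      using compactin_subset_topspace[OF that] by (simp add: double_diff)
  qed
  have emo: "emeasure \<mu> U = inner U" if "openin T U" for U
    using that em ob outer_open by simp
  have "radon_measure T \<mu>"
    unfolding radon_measure_def
  proof (intro conjI ballI allI impI)
    show "space \<mu> = topspace T"
      unfolding \<mu>_def using opens by (simp add: space_measure_of)
    show "sets \<mu> = borel_sigma T" by (rule sets)
    fix K assume K: "compactin T K"
    obtain U L where "openin T U" "compactin T L" "K \<subseteq> U" "U \<subseteq> L"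
      using locally_compact_space_compact_closed_compact[of T] Hausdorff locally_compact K by metis
    then have "outer K \<le> ennreal (l L)"
      using outer_le_compact by blast
    then show "emeasure \<mu> K < \<infinity>"
      using em[OF cb[OF K]] by (simp add: le_less_trans)
  next
    fix E assume "E \<in> sets \<mu>"
    then show "emeasure \<mu> E = (INF U\<in>{U. openin T U \<and> E \<subseteq> U}. emeasure \<mu> U)"
      using em sets emo by (simp add: outer_def)
  next
    fix U assume U: "openin T U"
    show "emeasure \<mu> U = (SUP K\<in>{K. compactin T K \<and> K \<subseteq> U}. emeasure \<mu> K)"
    proof (rule antisym)
      show "emeasure \<mu> U \<le> (SUP K\<in>{K. compactin T K \<and> K \<subseteq> U}. emeasure \<mu> K)"
        unfolding emo[OF U] inner_def
      proof (rule SUP_mono)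
        fix K assume "K \<in> {K. compactin T K \<and> K \<subseteq> U}"
        then show "\<exists>L\<in>{K. compactin T K \<and> K \<subseteq> U}. ennreal (l K) \<le> emeasure \<mu> L"
          using le_outer_compact em cb by auto
      qed
      show "(SUP K\<in>{K. compactin T K \<and> K \<subseteq> U}. emeasure \<mu> K) \<le> emeasure \<mu> U"
        using U ob sets by (intro SUP_least emeasure_mono) auto
    qed
  qed
  then show thesis
    using emo by (rule that)
qed

end

section \<open>Covering numbers\<close>

context locally_compact_group
begin

text \<open>Haar's index (K : V). The least number is meaningful once some finite cover exists,
  which is guaranteed for compact \<open>K\<close> and an open \<open>V\<close> containing the
  identity.\<close>

definition cover_number :: "'a set \<Rightarrow> 'a set \<Rightarrow> nat" where
  "cover_number K V = (LEAST n. \<exists>A. finite A \<and> A \<subseteq> carrier G \<and> card A = n \<and> K \<subseteq> (\<Union>a\<in>A. a <# V))"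

lemma cover_number_le:
  "finite A \<Longrightarrow> A \<subseteq> carrier G \<Longrightarrow> K \<subseteq> (\<Union>a\<in>A. a <# V) \<Longrightarrow> cover_number K V \<le> card A"
  unfolding cover_number_def by (rule Least_le) auto

lemma cover_number_attained:
  assumes K: "compactin T K" and V: "openin T V" "\<one> \<in> V"
  obtains A where "finite A" "A \<subseteq> carrier G" "card A = cover_number K V" "K \<subseteq> (\<Union>a\<in>A. a <# V)"
proof -
  have KG: "K \<subseteq> carrier G"
    using compactin_subset_topspace[OF K] topspace_eq by simp
  have "K \<subseteq> \<Union>((\<lambda>a. a <# V) ` K)"
  proof
    fix x assume x: "x \<in> K"
    then have "x = x \<otimes> \<one>"
      using KG by auto
    then have "x \<in> x <# V"
      using V unfolding l_coset_def by blast
    then show "x \<in> \<Union>((\<lambda>a. a <# V) ` K)"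
      using x by blast
  qed
  then have "\<exists>\<F>. finite \<F> \<and> \<F> \<subseteq> (\<lambda>a. a <# V) ` K \<and> K \<subseteq> \<Union>\<F>"
    using openin_l_coset[OF _ V(1)] KG by (intro compactinD[OF K]) auto
  then obtain D where D: "finite D" "D \<subseteq> K" "K \<subseteq> \<Union>((\<lambda>a. a <# V) ` D)"
    by (metis finite_subset_image)
  then have "\<exists>n A. finite A \<and> A \<subseteq> carrier G \<and> card A = n \<and> K \<subseteq> (\<Union>a\<in>A. a <# V)"
    using KG by (intro exI[of _ "card D"] exI[of _ D]) auto
  then have "\<exists>A. finite A \<and> A \<subseteq> carrier G \<and> card A = cover_number K V \<and> K \<subseteq> (\<Union>a\<in>A. a <# V)"
    unfolding cover_number_def by (rule LeastI_ex)
  then show thesis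
    using that by metis
qed

context
  fixes V assumes V: "openin T V" "\<one> \<in> V"
begin

lemma identity_neighbourhood_subset: "V \<subseteq> carrier G"
  using V openin_subset topspace_eq by metis

lemma cover_number_mono:
  assumes "compactin T L" "K \<subseteq> L"
  shows "cover_number K V \<le> cover_number L V"
proof -
  obtain A where "finite A" "A \<subseteq> carrier G" "card A = cover_number L V" "L \<subseteq> (\<Union>a\<in>A. a <# V)"
    using cover_number_attained[OF assms(1) V] by metis
  then show ?thesis
    using cover_number_le[of A K V] assms(2) by auto
qed

lemma cover_number_Un:
  assumes "compactin T K" "compactin T L"
  shows "cover_number (K \<union> L) V \<le> cover_number K V + cover_number L V"
proof -
  obtain A where A: "finite A" "A \<subseteq> carrier G" "card A = cover_number K V" "K \<subseteq> (\<Union>a\<in>A. a <# V)"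
    using cover_number_attained[OF assms(1) V] by metis
  obtain B where B: "finite B" "B \<subseteq> carrier G" "card B = cover_number L V" "L \<subseteq> (\<Union>a\<in>B. a <# V)"
    using cover_number_attained[OF assms(2) V] by metis
  have "cover_number (K \<union> L) V \<le> card (A \<union> B)"
    using A B by (intro cover_number_le) auto
  also have "\<dots> \<le> card A + card B"
    by (rule card_Un_le)
  finally show ?thesis
    using A B by simp
qed

lemma cover_number_l_coset_le:
  assumes K: "compactin T K" and s: "s \<in> carrier G"
  shows "cover_number (s <# K) V \<le> cover_number K V"
proof -
  obtain A where A: "finite A" "A \<subseteq> carrier G" "card A = cover_number K V" "K \<subseteq> (\<Union>a\<in>A. a <# V)"
    using cover_number_attained[OF K V] by metis
  have "s <# K \<subseteq> (\<Union>a\<in>(\<lambda>a. s \<otimes> a) ` A. a <# V)"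
  proof
    fix y assume "y \<in> s <# K"
    then obtain x where x: "x \<in> K" "y = s \<otimes> x"
      by (auto simp: l_coset_def)
    then obtain a v where a: "a \<in> A" "v \<in> V" "x = a \<otimes> v"
      using A(4) by (auto simp: l_coset_def)
    then have "y = (s \<otimes> a) \<otimes> v"
      using x(2) s A(2) identity_neighbourhood_subset m_assoc[of s a v] by (simp add: subset_iff)
    then show "y \<in> (\<Union>a\<in>(\<lambda>a. s \<otimes> a) ` A. a <# V)"
      using a by (auto simp: l_coset_def)
  qed
  then have "cover_number (s <# K) V \<le> card ((\<lambda>a. s \<otimes> a) ` A)"
    using A s by (intro cover_number_le) auto
  also have "\<dots> \<le> card A"
    using A card_image_le by blast
  finally show ?thesis
    using A by simp
qed

text \<open>Translates of \<open>W\<close> cover \<open>K\<close>, and translates of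
  \<open>V\<close> cover \<open>L\<close> and hence \<open>W\<close>; products of the translating
  elements then cover \<open>K\<close> by translates of \<open>V\<close>. Divided by (L : V), this
  bounds the index of \<open>K\<close> relative to \<open>L\<close> independently of
  \<open>V\<close>, which confines it to a compact interval.\<close>

lemma cover_number_le_mult:
  assumes K: "compactin T K" and W: "openin T W" "\<one> \<in> W" "W \<subseteq> L" "compactin T L"
  shows "cover_number K V \<le> cover_number K W * cover_number L V"
proof -
  obtain A where A: "finite A" "A \<subseteq> carrier G" "card A = cover_number K W" "K \<subseteq> (\<Union>a\<in>A. a <# W)"
    using cover_number_attained[OF K W(1,2)] by metis
  obtain B where B: "finite B" "B \<subseteq> carrier G" "card B = cover_number L V" "L \<subseteq> (\<Union>a\<in>B. a <# V)"
    using cover_number_attained[OF W(4) V] by metis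
  let ?C = "(\<lambda>(a, b). a \<otimes> b) ` (A \<times> B)"
  have "K \<subseteq> (\<Union>c\<in>?C. c <# V)"
  proof
    fix x assume "x \<in> K"
    then obtain a w where a: "a \<in> A" "w \<in> W" "x = a \<otimes> w"
      using A(4) by (auto simp: l_coset_def)
    then obtain b v where b: "b \<in> B" "v \<in> V" "w = b \<otimes> v"
      using B(4) W(3) by (force simp: l_coset_def)
    have "x = (a \<otimes> b) \<otimes> v"
      using a b A(2) B(2) identity_neighbourhood_subset m_assoc[of a b v] by (simp add: subset_iff)
    then show "x \<in> (\<Union>c\<in>?C. c <# V)"
      using a b unfolding l_coset_def by blast
  qed
  then have "cover_number K V \<le> card ?C"
    using A B by (intro cover_number_le) auto
  also have "\<dots> \<le> card (A \<times> B)"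
    using A B by (intro card_image_le) auto
  finally show ?thesis
    using A B by (simp add: card_cartesian_product)
qed

lemma cover_number_pos:
  assumes K: "compactin T K" "K \<noteq> {}"
  shows "cover_number K V > 0"
proof -
  obtain A where "finite A" "A \<subseteq> carrier G" "card A = cover_number K V" "K \<subseteq> (\<Union>a\<in>A. a <# V)"
    using cover_number_attained[OF K(1) V] by metis
  then show ?thesis
    using K(2) by (cases "A = {}") (auto simp: card_gt_0_iff)
qed

text \<open>No translate of \<open>V\<close> meets both sets, so an optimal cover of the union
  contains disjoint covers of \<open>K\<close> and of \<open>L\<close>.\<close>

lemma cover_number_separated:
  assumes K: "compactin T K" and L: "compactin T L"
    and sep: "\<And>a. a \<in> carrier G \<Longrightarrow> (a <# V) \<inter> K = {} \<or> (a <# V) \<inter> L = {}"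
  shows "cover_number (K \<union> L) V = cover_number K V + cover_number L V"
proof (rule antisym[OF cover_number_Un[OF K L]])
  obtain A where A: "finite A" "A \<subseteq> carrier G" "card A = cover_number (K \<union> L) V" "K \<union> L \<subseteq> (\<Union>a\<in>A. a <# V)"
    using cover_number_attained[OF compactin_Un[OF K L] V] by metis
  define B where "B = {a\<in>A. (a <# V) \<inter> K \<noteq> {}}"
  define C where "C = {a\<in>A. (a <# V) \<inter> L \<noteq> {}}"
  have "B \<inter> C = {}"
    using sep A(2) unfolding B_def C_def by blast
  have K': "K \<subseteq> (\<Union>a\<in>B. a <# V)"
  proof
    fix x assume x: "x \<in> K"
    then obtain a where "a \<in> A" "x \<in> a <# V"
      using A(4) by blast
    then show "x \<in> (\<Union>a\<in>B. a <# V)"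
      using x by (intro UN_I[of a]) (auto simp: B_def)
  qed
  have L': "L \<subseteq> (\<Union>a\<in>C. a <# V)"
  proof
    fix x assume x: "x \<in> L"
    then obtain a where "a \<in> A" "x \<in> a <# V"
      using A(4) by blast
    then show "x \<in> (\<Union>a\<in>C. a <# V)"
      using x by (intro UN_I[of a]) (auto simp: C_def)
  qed
  have "finite B" "B \<subseteq> carrier G" "finite C" "C \<subseteq> carrier G"
    using A(1,2) by (auto simp: B_def C_def)
  then have "cover_number K V \<le> card B" "cover_number L V \<le> card C"
    using cover_number_le K' L' by metis+
  then have "cover_number K V + cover_number L V \<le> card (B \<union> C)"
    using card_Un_disjoint[OF _ _ \<open>B \<inter> C = {}\<close>] A(1) by (simp add: B_def C_def)
  also have "\<dots> \<le> card A"
    using A(1) by (intro card_mono) (auto simp: B_def C_def)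
  finally show "cover_number K V + cover_number L V \<le> cover_number (K \<union> L) V"
    using A by simp
qed

end

lemma compact_l_coset:
  assumes "compactin T K" "s \<in> carrier G"
  shows "compactin T (s <# K)"
proof -
  have "compactin T ((\<lambda>x. s \<otimes> x) ` K)"
    using homeomorphic_maps_left_translation[OF assms(2)] image_compactin[OF assms(1)]
    by (auto simp: homeomorphic_maps_def)
  moreover have "(\<lambda>x. s \<otimes> x) ` K = s <# K"
    by (auto simp: l_coset_def)
  ultimately show ?thesis by simp
qed

lemma l_coset_inv_cancel:
  assumes "K \<subseteq> carrier G" "s \<in> carrier G"
  shows "inv s <# (s <# K) = K"
  using assms lcos_m_assoc[of K "inv s" s] lcos_mult_one[of K] by simp

lemma cover_number_l_coset:
  assumes K: "compactin T K" and s: "s \<in> carrier G" and V: "openin T V" "\<one> \<in> V"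
  shows "cover_number (s <# K) V = cover_number K V"
proof (rule antisym[OF cover_number_l_coset_le[OF V K s]])
  have "K \<subseteq> carrier G"
    using compactin_subset_topspace[OF K] topspace_eq by simp
  then show "cover_number K V \<le> cover_number (s <# K) V"
    using cover_number_l_coset_le[OF V compact_l_coset[OF K s], of "inv s"] s l_coset_inv_cancel[of K s] by simp
qed

text \<open>If a u lies in \<open>K\<close> and a v in \<open>L\<close>, then u^-1 v lies in K^-1 L,
  whatever a is. This compact set misses the identity because \<open>K\<close> and \<open>L\<close>
  are disjoint, so one small neighbourhood of the identity works for all a at once.\<close>

lemma separating_neighbourhood:
  assumes K: "compactin T K" and L: "compactin T L" and "disjnt K L"
  obtains V where "openin T V" "\<one> \<in> V"
    "\<And>a. a \<in> carrier G \<Longrightarrow> (a <# V) \<inter> K = {} \<or> (a <# V) \<inter> L = {}"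
proof -
  let ?q = "\<lambda>p. inv (fst p) \<otimes> snd p"
  have q: "continuous_map (prod_topology T T) T ?q"
    by (intro continuous_map_group_mult continuous_map_group_inv continuous_map_fst continuous_map_snd)
  have sub: "K \<subseteq> carrier G" "L \<subseteq> carrier G"
    using K L compactin_subset_topspace topspace_eq by metis+
  have "compactin T (?q ` (K \<times> L))"
    using K L q by (intro image_compactin[of "prod_topology T T"]) (auto simp: compactin_Times)
  then have "closedin T (?q ` (K \<times> L))"
    using Hausdorff compactin_imp_closedin by blast
  then have "openin T (topspace T - ?q ` (K \<times> L))"
    by blast
  from openin_continuous_map_preimage[OF q this]
  have W: "openin (prod_topology T T)
     {p \<in> topspace (prod_topology T T). ?q p \<in> topspace T - ?q ` (K \<times> L)}" (is "openin _ ?W") .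
  have "\<one> \<notin> ?q ` (K \<times> L)"
  proof
    assume "\<one> \<in> ?q ` (K \<times> L)"
    then obtain x y where xy: "x \<in> K" "y \<in> L" "\<one> = inv x \<otimes> y"
      by auto
    then have "x = x \<otimes> (inv x \<otimes> y)"
      using sub by (metis r_one subsetD)
    also have "\<dots> = y"
      using xy sub by (simp add: m_assoc[symmetric] subset_iff)
    finally show False
      using xy \<open>disjnt K L\<close> by (auto simp: disjnt_iff)
  qed
  then have "(\<one>, \<one>) \<in> ?W"
    using topspace_eq by auto
  then obtain U1 U2 where U: "openin T U1" "openin T U2" "\<one> \<in> U1" "\<one> \<in> U2" "U1 \<times> U2 \<subseteq> ?W"
    using W unfolding openin_prod_topology_alt by meson
  show thesis
  proof (rule that[of "U1 \<inter> U2"])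
    show "openin T (U1 \<inter> U2)" "\<one> \<in> U1 \<inter> U2"
      using U by auto
    fix a assume a: "a \<in> carrier G"
    show "(a <# (U1 \<inter> U2)) \<inter> K = {} \<or> (a <# (U1 \<inter> U2)) \<inter> L = {}"
    proof (rule ccontr)
      assume "\<not> ?thesis"
      then obtain u v where uv: "u \<in> U1" "v \<in> U2" "a \<otimes> u \<in> K" "a \<otimes> v \<in> L"
        by (auto simp: l_coset_def)
      have c: "u \<in> carrier G" "v \<in> carrier G"
        using uv U openin_subset topspace_eq by blast+
      have "inv u \<otimes> v = inv (a \<otimes> u) \<otimes> (a \<otimes> v)"
      proof -
        have "inv (a \<otimes> u) \<otimes> (a \<otimes> v) = inv u \<otimes> ((inv a \<otimes> a) \<otimes> v)"
          using a c by (simp only: inv_mult_group m_assoc m_closed inv_closed)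
        then show ?thesis using a c by simp
      qed
      then have "inv u \<otimes> v \<in> ?q ` (K \<times> L)"
        using uv by (intro image_eqI[of _ _ "(a \<otimes> u, a \<otimes> v)"]) auto
      moreover have "(u, v) \<in> ?W"
        using uv U by blast
      ultimately show False by auto
    qed
  qed
qed

end

section \<open>Invariant content and existence of the measure\<close>

context locally_compact_group
begin

text \<open>
  A cluster point of the normalised covering numbers, as the covering set shrinks to the identity,
  is an invariant content; compactness of a product of intervals provides it.
\<close>

lemma invariant_content_exists:
  obtains l K0 where "content T l" "compactin T K0" "l K0 = 1"
    "\<And>s K. s \<in> carrier G \<Longrightarrow> compactin T K \<Longrightarrow> l (s <# K) = l K"
proof -
  obtain W0 K0 where W0: "openin T W0" "compactin T K0" "\<one> \<in> W0" "W0 \<subseteq> K0"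
    using locally_compact one_closed unfolding locally_compact_space_def topspace_eq by meson
  \<comment> \<open>The value 0 on non-compact sets makes \<open>\<Lambda> V\<close> a function on
    all sets, thus a point of a full product space.\<close>
  define \<Lambda> where "\<Lambda> V K = (if compactin T K then real (cover_number K V) / real (cover_number K0 V) else 0)"
    for V K
  define Nb where "Nb = {V. openin T V \<and> \<one> \<in> V}"
  \<comment> \<open>Neighbourhoods shrinking to the identity: a property holds eventually as soon as
    it holds for all members of \<open>Nb\<close> inside some \<open>V\<close> in
    \<open>Nb\<close>.\<close>
  define F where "F = (INF V\<in>Nb. principal {U \<in> Nb. U \<subseteq> V})"
  have F: "F \<noteq> bot"
  proof -
    have "\<exists>k\<in>Nb. principal {U \<in> Nb. U \<subseteq> k} \<le> inf (principal {U \<in> Nb. U \<subseteq> i}) (principal {U \<in> Nb. U \<subseteq> j})"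
      if "i \<in> Nb" "j \<in> Nb" for i j
      using that by (intro bexI[of _ "i \<inter> j"]) (auto simp: Nb_def)
    then show ?thesis
      unfolding F_def by (subst INF_filter_bot_base) (auto simp: principal_eq_bot_iff)
  qed
  have evF: "eventually P F" if "V \<in> Nb" "\<And>U. U \<in> Nb \<Longrightarrow> U \<subseteq> V \<Longrightarrow> P U" for P V
    unfolding F_def by (rule eventually_INF1[OF that(1)]) (use that(2) in \<open>auto simp: eventually_principal\<close>)
  \<comment> \<open>A bound independent of the covering set, from
    \<open>cover_number_le_mult\<close> with \<open>K0\<close> as the compact set around
    \<open>W0\<close>.\<close>
  define b where "b K = (if compactin T K then real (cover_number K W0) else 0)" for K
  define B where "B = (PiE UNIV (\<lambda>K. {0..b K}))"
  have "compactin (product_topology (\<lambda>i. euclidean) UNIV) B"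
    unfolding B_def by (subst compactin_PiE) auto
  then have "compact B"
    by (simp add: euclidean_product_topology)
  have pos: "cover_number K0 V > 0" if "V \<in> Nb" for V
    using cover_number_pos[OF _ _ W0(2)] that W0 by (auto simp: Nb_def)
  have "\<one> \<in> topspace T"
    by (simp add: topspace_eq)
  then have top: "topspace T \<in> Nb"
    by (simp add: Nb_def)
  have "eventually (\<lambda>V. \<Lambda> V \<in> B) F"
  proof (rule evF[OF top])
    fix V assume V: "V \<in> Nb"
    have "\<Lambda> V K \<le> b K" for K
    proof (cases "compactin T K")
      case True
      have "cover_number K V \<le> cover_number K W0 * cover_number K0 V"
        using cover_number_le_mult[of V K W0 K0] True V W0 by (simp add: Nb_def)
      then have "real (cover_number K V) \<le> real (cover_number K W0) * real (cover_number K0 V)"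
        by (metis of_nat_le_iff of_nat_mult)
      then show ?thesis
        using True pos[OF V] by (simp add: \<Lambda>_def b_def pos_divide_le_eq)
    qed (simp add: \<Lambda>_def b_def)
    moreover have "0 \<le> \<Lambda> V K" for K
      by (simp add: \<Lambda>_def)
    ultimately show "\<Lambda> V \<in> B"
      by (auto simp: B_def)
  qed
  then have "eventually (\<lambda>m. m \<in> B) (filtermap \<Lambda> F)"
    by (simp add: eventually_filtermap)
  then obtain l where nb: "inf (nhds l) (filtermap \<Lambda> F) \<noteq> bot"
    using \<open>compact B\<close> F unfolding compact_filter by (metis filtermap_bot_iff)
  \<comment> \<open>Along \<open>F'\<close> evaluation at each \<open>K\<close> converges to
    \<open>l K\<close>, while everything eventually true of \<open>\<Lambda>\<close> remains true;
    identities and inequalities thus pass to \<open>l\<close> as limits.\<close>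
  define F' where "F' = inf (nhds l) (filtermap \<Lambda> F)"
  have tend: "((\<lambda>m. m K) \<longlongrightarrow> l K) F'" for K
  proof -
    have "((\<lambda>m. m K) \<longlongrightarrow> l K) (nhds l)"
    proof (rule topological_tendstoI)
      fix S :: "real set" assume S: "open S" "l K \<in> S"
      have "open ((\<lambda>m. m K) -` S)"
        by (rule open_vimage[OF S(1) continuous_on_product_coordinates])
      then show "eventually (\<lambda>m. m K \<in> S) (nhds l)"
        using S(2) unfolding eventually_nhds by (intro exI[of _ "(\<lambda>m. m K) -` S"]) auto
    qed
    then show ?thesis
      unfolding F'_def by (rule filterlim_mono) auto
  qed
  have evF': "eventually P F'" if "V \<in> Nb" "\<And>U. U \<in> Nb \<Longrightarrow> U \<subseteq> V \<Longrightarrow> P (\<Lambda> U)" for P V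
    unfolding F'_def
    by (rule filter_leD[OF inf_le2]) (use evF[OF that(1)] that(2) in \<open>simp add: eventually_filtermap\<close>)
  have nb': "F' \<noteq> bot"
    using nb by (simp add: F'_def)
  show thesis
  proof (rule that[of l K0])
    show "compactin T K0" by fact
    show "l K0 = 1"
    proof (rule tendsto_unique[OF nb' tend])
      have "eventually (\<lambda>m. 1 = m K0) F'"
        by (rule evF'[OF top]) (use pos W0 in \<open>simp add: \<Lambda>_def\<close>)
      then show "((\<lambda>m. m K0) \<longlongrightarrow> 1) F'"
        by (rule Lim_transform_eventually[OF tendsto_const])
    qed
    show "l (s <# K) = l K" if s: "s \<in> carrier G" and K: "compactin T K" for s K
    proof (rule tendsto_unique[OF nb' tend])
      have "eventually (\<lambda>m. m K = m (s <# K)) F'"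
        by (rule evF'[OF top])
          (use cover_number_l_coset[OF K s] compact_l_coset[OF K s] K in \<open>simp add: \<Lambda>_def Nb_def\<close>)
      then show "((\<lambda>m. m (s <# K)) \<longlongrightarrow> l K) F'"
        by (rule Lim_transform_eventually[OF tend])
    qed
    show "content T l"
    proof
      show "Hausdorff_space T" "locally_compact_space T"
        by (rule Hausdorff, rule locally_compact)
      fix K assume K: "compactin T K"
      show "0 \<le> l K"
        by (rule tendsto_lowerbound[OF tend _ nb']) (rule evF'[OF top], simp add: \<Lambda>_def)
      fix L assume L: "compactin T L"
      have KL: "compactin T (K \<union> L)"
        by (rule compactin_Un[OF K L])
      show "l K \<le> l L" if "K \<subseteq> L"
        by (rule tendsto_le[OF nb' tend tend], rule evF'[OF top])
          (use cover_number_mono[OF _ _ L that] K L in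
            \<open>auto simp add: \<Lambda>_def Nb_def intro!: divide_right_mono\<close>)
      show "l (K \<union> L) \<le> l K + l L"
      proof (rule tendsto_le[OF nb' tendsto_add[OF tend tend] tend], rule evF'[OF top])
        fix V assume "V \<in> Nb"
        then have "real (cover_number (K \<union> L) V) \<le> real (cover_number K V) + real (cover_number L V)"
          using cover_number_Un[OF _ _ K L] by (simp add: Nb_def flip: of_nat_add)
        then show "\<Lambda> V (K \<union> L) \<le> \<Lambda> V K + \<Lambda> V L"
          using K L KL by (simp add: \<Lambda>_def divide_right_mono flip: add_divide_distrib)
      qed
      show "l (K \<union> L) = l K + l L" if d: "disjnt K L"
      proof (rule tendsto_unique[OF nb' tend])
        obtain V where V: "openin T V" "\<one> \<in> V"
          "\<And>a. a \<in> carrier G \<Longrightarrow> (a <# V) \<inter> K = {} \<or> (a <# V) \<inter> L = {}"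
          using separating_neighbourhood[OF K L d] by metis
        \<comment> \<open>Exact additivity sets in once the covering set lies inside a neighbourhood
          separating \<open>K\<close> from \<open>L\<close>.\<close>
        have "eventually (\<lambda>m. m K + m L = m (K \<union> L)) F'"
        proof (rule evF')
          show "V \<in> Nb" using V by (simp add: Nb_def)
          fix U assume U: "U \<in> Nb" "U \<subseteq> V"
          have "(a <# U) \<inter> K = {} \<or> (a <# U) \<inter> L = {}" if "a \<in> carrier G" for a
          proof -
            have "a <# U \<subseteq> a <# V"
              using U(2) by (auto simp: l_coset_def)
            then show ?thesis
              using V(3)[OF that] by blast
          qed
          then have "cover_number (K \<union> L) U = cover_number K U + cover_number L U"
            using U by (intro cover_number_separated K L) (auto simp: Nb_def)
          then show "\<Lambda> U K + \<Lambda> U L = \<Lambda> U (K \<union> L)"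
            using K L KL by (simp add: \<Lambda>_def add_divide_distrib)
        qed
        then show "((\<lambda>m. m (K \<union> L)) \<longlongrightarrow> l K + l L) F'"
          by (rule Lim_transform_eventually[OF tendsto_add[OF tend tend]])
      qed
    qed
  qed
qed

text \<open>Invariance of \<open>l\<close> passes to its suprema on open sets and then, by outer
  regularity, to Borel sets. It is proved as an inequality, whose converse is the case of the
  inverse element; \<open>l K0 = 1\<close> excludes the zero measure.\<close>

theorem left_haar_measure_exists:
  obtains \<mu> where "left_haar_measure G T \<mu>"
proof -
  obtain l K0 where l: "content T l" "compactin T K0" "l K0 = 1"
    "\<And>s K. s \<in> carrier G \<Longrightarrow> compactin T K \<Longrightarrow> l (s <# K) = l K"
    using invariant_content_exists by metis
  interpret content T l by fact
  obtain \<mu> where \<mu>: "radon_measure T \<mu>" "\<And>U. openin T U \<Longrightarrow> emeasure \<mu> U = inner U"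
    using radon_measure_of_content by metis
  interpret radon T \<mu>
    using \<mu>(1) Hausdorff by unfold_locales
  have cosub: "inv s <# E \<subseteq> U" if "E \<subseteq> s <# U" "s \<in> carrier G" "U \<subseteq> carrier G" for s E U
  proof -
    have "inv s <# E \<subseteq> inv s <# (s <# U)"
      using that(1) by (auto simp: l_coset_def)
    then show ?thesis
      using l_coset_inv_cancel[OF that(3,2)] by simp
  qed
  have le_open: "emeasure \<mu> (s <# U) \<le> emeasure \<mu> U" if s: "s \<in> carrier G" and U: "openin T U" for s U
    unfolding \<mu>(2)[OF U] \<mu>(2)[OF openin_l_coset[OF s U]] inner_def[of "s <# U"]
  proof (rule SUP_least)
    fix K assume "K \<in> {K. compactin T K \<and> K \<subseteq> s <# U}"
    then have K: "compactin T K" "K \<subseteq> s <# U" by auto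
    have "ennreal (l K) = ennreal (l (inv s <# K))"
      using l(4)[of "inv s" K] s K by simp
    also have "\<dots> \<le> inner U"
      using cosub[OF K(2) s] openin_subset[OF U] topspace_eq compact_l_coset[OF K(1)] s
      by (intro inner_upper) auto
    finally show "ennreal (l K) \<le> inner U" .
  qed
  have le: "emeasure \<mu> (s <# E) \<le> emeasure \<mu> E" if s: "s \<in> carrier G" and E: "E \<in> sets \<mu>" for s E
    unfolding outer_regular[OF E]
  proof (rule INF_greatest)
    fix U assume "U \<in> {U. openin T U \<and> E \<subseteq> U}"
    then have U: "openin T U" "E \<subseteq> U" by auto
    have "s <# E \<subseteq> s <# U"
      using U(2) by (auto simp: l_coset_def)
    then have "emeasure \<mu> (s <# E) \<le> emeasure \<mu> (s <# U)"
      using open_sets[OF openin_l_coset[OF s U(1)]] by (rule emeasure_mono)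
    also have "\<dots> \<le> emeasure \<mu> U"
      by (rule le_open[OF s U(1)])
    finally show "emeasure \<mu> (s <# E) \<le> emeasure \<mu> U" .
  qed
  have "left_haar_measure G T \<mu>"
    unfolding left_haar_measure_def
  proof (intro conjI ballI)
    have "ennreal (l K0) \<le> inner (topspace T)"
      using l(2) compactin_subset_topspace by (intro inner_upper) auto
    then show "emeasure \<mu> (space \<mu>) \<noteq> 0"
      using l(3) \<mu>(2)[OF openin_topspace] by auto
    fix s E assume s: "s \<in> carrier G" and E: "E \<in> sets \<mu>"
    have EG: "E \<subseteq> carrier G"
      using sets.sets_into_space[OF E] topspace_eq by simp
    have "(\<lambda>x. s \<otimes> x) ` E = s <# E"
      by (auto simp: l_coset_def)
    then have sE: "s <# E \<in> sets \<mu>"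
      using homeomorphic_image_sets[OF _ E] homeomorphic_maps_left_translation[OF s]
        homeomorphic_maps_sym by metis
    have "emeasure \<mu> E \<le> emeasure \<mu> (s <# E)"
      using le[OF _ sE, of "inv s"] l_coset_inv_cancel[OF EG s] s by simp
    then show "emeasure \<mu> (s <# E) = emeasure \<mu> E"
      using le[OF s E] by (rule antisym[rotated])
  qed (rule \<mu>(1))
  then show thesis
    by (rule that)
qed

end

section \<open>The modular function\<close>

context haar
begin

text \<open>Evaluating on such a set is what allows scalar factors of extended nonnegative measures
  to be compared.\<close>

lemma finite_positive_set:
  obtains K where "compactin T K" "K \<in> sets \<mu>" "0 < emeasure \<mu> K" "emeasure \<mu> K < \<infinity>"
proof -
  obtain W K where W: "openin T W" "compactin T K" "\<one> \<in> W" "W \<subseteq> K"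
    using locally_compact one_closed unfolding locally_compact_space_def topspace_eq by meson
  have "0 < emeasure \<mu> W"
    using emeasure_open_pos[OF W(1)] W(3) by auto
  also have "\<dots> \<le> emeasure \<mu> K"
    using W compact_sets by (intro emeasure_mono) auto
  finally show thesis
    using that[OF W(2)] compact_sets[OF W(2)] finite_compact[OF W(2)] by simp
qed

lemma ennreal_scale_eqD:
  assumes "0 < emeasure \<mu> E" "emeasure \<mu> E < \<infinity>" "ennreal c * emeasure \<mu> E = ennreal d * emeasure \<mu> E"
    and "c > 0" "d > 0"
  shows "c = d"
proof (cases "emeasure \<mu> E")
  case (real r)
  then have "ennreal (c * r) = ennreal (d * r)" "r > 0"
    using assms by (auto simp: ennreal_mult)
  then show ?thesis
    using assms real by simp
qed (use assms in simp)

text \<open>The inverse stands in the forward map because pushing \<open>\<mu>\<close> forward along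
  x \<mapsto> x s^-1 gives E the measure of E s, the quantity in the definition of the modular
  function.\<close>

lemma right_translation_maps:
  assumes "s \<in> carrier G"
  shows "homeomorphic_maps T T (\<lambda>x. x \<otimes> inv s) (\<lambda>x. x \<otimes> s)"
  using homeomorphic_maps_right_translation[of "inv s"] assms by simp

lemma r_coset_sets:
  assumes "s \<in> carrier G" "E \<in> sets \<mu>"
  shows "E #> s \<in> sets \<mu>"
proof -
  have "(\<lambda>x. x \<otimes> s) ` E = E #> s"
    by (auto simp: r_coset_def)
  then show ?thesis
    using homeomorphic_image_sets[OF right_translation_maps[OF assms(1)] assms(2)] by simp
qed

lemma emeasure_distr_right_translation:
  assumes "s \<in> carrier G" "E \<in> sets \<mu>"
  shows "emeasure (distr \<mu> \<mu> (\<lambda>x. x \<otimes> inv s)) E = emeasure \<mu> (E #> s)"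
proof -
  have "(\<lambda>x. x \<otimes> s) ` E = E #> s"
    by (auto simp: r_coset_def)
  then show ?thesis
    using emeasure_distr_homeomorphic[OF right_translation_maps[OF assms(1)] assms(2)] by simp
qed

text \<open>Left and right translations commute, so translating on the right preserves left
  invariance.\<close>

lemma left_haar_distr_right_translation:
  assumes s: "s \<in> carrier G"
  shows "left_haar_measure G T (distr \<mu> \<mu> (\<lambda>x. x \<otimes> inv s))"
  unfolding left_haar_measure_def
proof (intro conjI ballI)
  note h = right_translation_maps[OF s]
  show "radon_measure T (distr \<mu> \<mu> (\<lambda>x. x \<otimes> inv s))"
    by (rule radon_distr[OF h])
  have "emeasure (distr \<mu> \<mu> (\<lambda>x. x \<otimes> inv s)) (space \<mu>) = emeasure \<mu> (space \<mu>)"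
    using measurable_space[OF homeomorphic_measurable[OF h]]
    by (subst emeasure_distr[OF homeomorphic_measurable[OF h] sets.top])
       (auto intro!: arg_cong[where f="emeasure \<mu>"])
  then show "emeasure (distr \<mu> \<mu> (\<lambda>x. x \<otimes> inv s)) (space (distr \<mu> \<mu> (\<lambda>x. x \<otimes> inv s))) \<noteq> 0"
    using left_haar by (simp add: left_haar_measure_def)
  fix a E assume a: "a \<in> carrier G" and "E \<in> sets (distr \<mu> \<mu> (\<lambda>x. x \<otimes> inv s))"
  then have E: "E \<in> sets \<mu>" "E \<subseteq> carrier G"
    using sets.sets_into_space topspace_eq by fastforce+
  have "(\<lambda>x. a \<otimes> x) ` E = a <# E"
    by (auto simp: l_coset_def)
  then have aE: "a <# E \<in> sets \<mu>"
    using homeomorphic_image_sets[OF _ E(1)] homeomorphic_maps_left_translation[OF a]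
      homeomorphic_maps_sym by metis
  have "(a <# E) #> s = a <# (E #> s)"
    using coset_assoc[OF a s E(2)] by simp
  then show "emeasure (distr \<mu> \<mu> (\<lambda>x. x \<otimes> inv s)) (a <# E) = emeasure (distr \<mu> \<mu> (\<lambda>x. x \<otimes> inv s)) E"
    using emeasure_distr_right_translation[OF s aE] emeasure_distr_right_translation[OF s E(1)]
      emeasure_l_coset[OF a r_coset_sets[OF s E(1)]] by simp
qed

text \<open>Uniqueness of Haar measure, applied to the right translate, gives \<open>c\<close> for
  \<open>\<mu>\<close>. Every other left Haar measure is a multiple of \<open>\<mu>\<close>, so the
  same \<open>c\<close> works for it. This gives meaning to the definite description in
  \<open>modular_function\<close>.\<close>

lemma modular_function_exists:
  assumes s: "s \<in> carrier G"
  shows "\<exists>!c. c > 0 \<and> (\<forall>\<nu>. left_haar_measure G T \<nu> \<longrightarrow>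
           (\<forall>E\<in>sets \<nu>. emeasure \<nu> (E #> s) = ennreal c * emeasure \<nu> E))"
proof -
  obtain c where c: "c > 0" "\<And>E. E \<in> sets \<mu> \<Longrightarrow> emeasure \<mu> (E #> s) = ennreal c * emeasure \<mu> E"
    using left_haar_measure_unique[OF left_haar_distr_right_translation[OF s]]
      emeasure_distr_right_translation[OF s] by metis
  have all: "emeasure \<nu> (E #> s) = ennreal c * emeasure \<nu> E"
    if \<nu>: "left_haar_measure G T \<nu>" and E: "E \<in> sets \<nu>" for \<nu> E
  proof -
    obtain d where d: "d > 0" "\<And>E. E \<in> sets \<mu> \<Longrightarrow> emeasure \<nu> E = ennreal d * emeasure \<mu> E"
      using left_haar_measure_unique[OF \<nu>] by metis
    have "E \<in> sets \<mu>"
      using E \<nu> sets_eq by (simp add: left_haar_measure_def radon_measure_def)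
    then show ?thesis
      using d(2) c(2) r_coset_sets[OF s] by (simp add: mult.left_commute)
  qed
  obtain K where K: "K \<in> sets \<mu>" "0 < emeasure \<mu> K" "emeasure \<mu> K < \<infinity>"
    using finite_positive_set by metis
  show ?thesis
  proof (rule ex1I[of _ c])
    show "c > 0 \<and> (\<forall>\<nu>. left_haar_measure G T \<nu> \<longrightarrow>
           (\<forall>E\<in>sets \<nu>. emeasure \<nu> (E #> s) = ennreal c * emeasure \<nu> E))"
      using c(1) all by blast
    fix d assume "d > 0 \<and> (\<forall>\<nu>. left_haar_measure G T \<nu> \<longrightarrow>
           (\<forall>E\<in>sets \<nu>. emeasure \<nu> (E #> s) = ennreal d * emeasure \<nu> E))"
    then have "d > 0" "ennreal d * emeasure \<mu> K = ennreal c * emeasure \<mu> K"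
      using c(2)[OF K(1)] K(1) left_haar by auto
    then show "d = c"
      using ennreal_scale_eqD[OF K(2,3)] c(1) by blast
  qed
qed

lemma modular_function_pos: "s \<in> carrier G \<Longrightarrow> modular_function G T s > 0"
  using theI'[OF modular_function_exists] unfolding modular_function_def by blast

lemma emeasure_r_coset:
  "s \<in> carrier G \<Longrightarrow> E \<in> sets \<mu> \<Longrightarrow> emeasure \<mu> (E #> s) = ennreal (modular_function G T s) * emeasure \<mu> E"
  using theI'[OF modular_function_exists] left_haar unfolding modular_function_def by blast

text \<open>The pushforward of \<open>\<mu>\<close> along x \<mapsto> x s^-1 is \<Delta>(s) \<mu>,
  and integrating f(x s) against it undoes the translation. Hence translating \<open>f\<close> on
  the right divides its integral by \<Delta>(s).\<close>

lemma integral_right_translation: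
  assumes s: "s \<in> carrier G" and f: "f \<in> Cc T"
  shows "modular_function G T s * (\<integral>x. f (x \<otimes> s) \<partial>\<mu>) = integral\<^sup>L \<mu> f"
proof -
  note h = right_translation_maps[OF s]
  let ?c = "modular_function G T s"
  have fs: "(\<lambda>x. f (x \<otimes> s)) \<in> Cc T"
    using Cc_homeomorphic_compose[OF homeomorphic_maps_right_translation[OF s] f] .
  have m: "(\<lambda>x. f (x \<otimes> s)) \<in> borel_measurable \<mu>"
    by (rule continuous_measurable[OF Cc_continuous[OF fs]])
  have d: "distr \<mu> \<mu> (\<lambda>x. x \<otimes> inv s) = density \<mu> (\<lambda>x. ennreal ?c)"
  proof (rule measure_eqI)
    fix E assume "E \<in> sets (distr \<mu> \<mu> (\<lambda>x. x \<otimes> inv s))"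
    then have "E \<in> sets \<mu>" by simp
    then show "emeasure (distr \<mu> \<mu> (\<lambda>x. x \<otimes> inv s)) E = emeasure (density \<mu> (\<lambda>x. ennreal ?c)) E"
      using emeasure_distr_right_translation[OF s] emeasure_r_coset[OF s]
      by (simp add: emeasure_density nn_integral_cmult_indicator)
  qed simp
  have "integral\<^sup>L \<mu> f = (\<integral>x. f ((x \<otimes> inv s) \<otimes> s) \<partial>\<mu>)"
    using s by (intro Bochner_Integration.integral_cong) (auto simp: topspace_eq m_assoc)
  also have "\<dots> = (\<integral>x. f (x \<otimes> s) \<partial>distr \<mu> \<mu> (\<lambda>x. x \<otimes> inv s))"
    by (rule integral_distr[OF homeomorphic_measurable[OF h] m, symmetric])
  also have "\<dots> = ?c * (\<integral>x. f (x \<otimes> s) \<partial>\<mu>)"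
    unfolding d using modular_function_pos[OF s] m by (subst integral_density) auto
  finally show ?thesis by simp
qed

lemma modular_function_mult:
  assumes s: "s \<in> carrier G" and t: "t \<in> carrier G"
  shows "modular_function G T (s \<otimes> t) = modular_function G T s * modular_function G T t"
proof -
  obtain K where K: "compactin T K" "K \<in> sets \<mu>" "0 < emeasure \<mu> K" "emeasure \<mu> K < \<infinity>"
    using finite_positive_set by metis
  have KG: "K \<subseteq> carrier G"
    using compactin_subset_topspace[OF K(1)] topspace_eq by simp
  have "ennreal (modular_function G T (s \<otimes> t)) * emeasure \<mu> K = emeasure \<mu> ((K #> s) #> t)"
    using emeasure_r_coset[of "s \<otimes> t" K] coset_mult_assoc[OF KG s t] s t K by simp
  also have "\<dots> = ennreal (modular_function G T s * modular_function G T t) * emeasure \<mu> K"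
    using emeasure_r_coset[OF t r_coset_sets[OF s K(2)]] emeasure_r_coset[OF s K(2)]
      modular_function_pos s t by (simp add: ennreal_mult less_imp_le ac_simps)
  finally show ?thesis
    using modular_function_pos s t by (intro ennreal_scale_eqD[OF K(3,4)]) auto
qed

lemma modular_function_one: "modular_function G T \<one> = 1"
  using modular_function_mult[of \<one> \<one>] modular_function_pos[of \<one>] by simp

end

section \<open>Closed normal subgroups\<close>

text \<open>Every point a of \<open>A\<close> has the neighbourhood a U inside \<open>A\<close>. In
  the final criterion each of the two subgroups is shown to be open this way, with \<open>U\<close>
  cut out of the other.\<close>

lemma (in topological_group) openin_of_identity_neighbourhood:
  assumes A: "A \<subseteq> carrier G" and O: "openin T U" "\<one> \<in> U"
    and AU: "\<And>a u. a \<in> A \<Longrightarrow> u \<in> U \<Longrightarrow> a \<otimes> u \<in> A"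
  shows "openin T A"
proof (subst openin_subopen, intro ballI)
  fix a assume a: "a \<in> A"
  then have "a \<in> a <# U"
    using O(2) A unfolding l_coset_def by (force simp: image_iff)
  moreover have "a <# U \<subseteq> A"
    using AU[OF a] by (auto simp: l_coset_def)
  moreover have "openin T (a <# U)"
    using a A O(1) by (intro openin_l_coset) auto
  ultimately show "\<exists>S. openin T S \<and> a \<in> S \<and> S \<subseteq> A"
    by blast
qed

context haar_subgroup
begin

lemma Cc_restrict:
  assumes f: "f \<in> Cc T"
  shows "f \<in> Cc (subtopology T N)"
proof -
  obtain K where K: "compactin T K" "\<And>x. x \<in> topspace T \<Longrightarrow> x \<notin> K \<Longrightarrow> f x = 0"
    using CcE[OF f] by metis
  have "compactin (subtopology T N) (N \<inter> K)"
    using closed_Int_compactin[OF closed K(1)] by (auto simp: compactin_subtopology)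
  moreover have "f x = 0" if "x \<in> topspace (subtopology T N)" "x \<notin> N \<inter> K" for x
    using that K(2) by auto
  ultimately show ?thesis
    using continuous_map_from_subtopology[OF Cc_continuous[OF f]] by (intro CcI)
qed

section \<open>Conjugation and the modular function of a normal subgroup\<close>

context
  assumes normal: "N \<lhd> G"
begin

lemma conjugate_closed: "x \<in> carrier G \<Longrightarrow> n \<in> N \<Longrightarrow> x \<otimes> n \<otimes> inv x \<in> N"
  using normal.inv_op_closed2[OF normal] by simp

lemma homeomorphic_maps_conjugation:
  assumes x: "x \<in> carrier G"
  shows "homeomorphic_maps (subtopology T N) (subtopology T N) (\<lambda>n. inv x \<otimes> n \<otimes> x) (\<lambda>n. x \<otimes> n \<otimes> inv x)"
proof -
  have "inv x \<otimes> n \<otimes> x \<in> N" if "n \<in> N" for n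
    using conjugate_closed[of "inv x" n] x that by simp
  moreover have c: "continuous_map (subtopology T N) T (\<lambda>n. a \<otimes> n \<otimes> b)"
    if "a \<in> carrier G" "b \<in> carrier G" for a b
    using that by (intro continuous_map_group_mult continuous_map_inclusion) (auto simp: topspace_eq)
  moreover have "x \<otimes> (inv x \<otimes> n \<otimes> x) \<otimes> inv x = n" "inv x \<otimes> (x \<otimes> n \<otimes> inv x) \<otimes> x = n" if "n \<in> N" for n
  proof -
    have n: "n \<in> carrier G" using N_subset that .
    have "x \<otimes> (inv x \<otimes> n \<otimes> x) \<otimes> inv x = (x \<otimes> inv x) \<otimes> n \<otimes> (x \<otimes> inv x)"
      using x n by (simp only: m_assoc m_closed inv_closed)
    then show "x \<otimes> (inv x \<otimes> n \<otimes> x) \<otimes> inv x = n"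
      using x n by simp
    have "inv x \<otimes> (x \<otimes> n \<otimes> inv x) \<otimes> x = (inv x \<otimes> x) \<otimes> n \<otimes> (inv x \<otimes> x)"
      using x n by (simp only: m_assoc m_closed inv_closed)
    then show "inv x \<otimes> (x \<otimes> n \<otimes> inv x) \<otimes> x = n"
      using x n by simp
  qed
  ultimately show ?thesis
    using x conjugate_closed unfolding homeomorphic_maps_def
    by (auto simp: continuous_map_in_subtopology)
qed

text \<open>Conjugation is an automorphism of \<open>N\<close> as a topological group, so it carries
  \<open>\<nu>\<close> to a left Haar measure, that is to a multiple \<open>c\<close> of
  \<open>\<nu>\<close>. It also carries right translation by \<open>m\<close> to right translation
  by its conjugate. The factor \<open>c\<close> need not be 1 but occurs on both sides and
  cancels.\<close>

lemma modular_function_conjugate: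
  assumes x: "x \<in> carrier G" and m: "m \<in> N"
  shows "modular_function (G\<lparr>carrier := N\<rparr>) (subtopology T N) (x \<otimes> m \<otimes> inv x)
       = modular_function (G\<lparr>carrier := N\<rparr>) (subtopology T N) m"
proof -
  let ?\<Delta> = "modular_function (G\<lparr>carrier := N\<rparr>) (subtopology T N)"
  let ?h = "\<lambda>n. inv x \<otimes> n \<otimes> x" and ?g = "\<lambda>n. x \<otimes> n \<otimes> inv x"
  note h = homeomorphic_maps_conjugation[OF x]
  let ?\<nu> = "distr \<nu> \<nu> ?h"
  have em: "emeasure ?\<nu> E = emeasure \<nu> (?g ` E)" if "E \<in> sets \<nu>" for E
    by (rule N.emeasure_distr_homeomorphic[OF h that])
  have gsets: "?g ` E \<in> sets \<nu>" if "E \<in> sets \<nu>" for E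
    by (rule N.homeomorphic_image_sets[OF h that])
  have EN: "E \<subseteq> N" if "E \<in> sets \<nu>" for E
    using sets.sets_into_space[OF that] by simp
  have gmult: "?g (a \<otimes> b) = ?g a \<otimes> ?g b" if "a \<in> N" "b \<in> N" for a b
  proof -
    have ab: "a \<in> carrier G" "b \<in> carrier G"
      using that N_subset by auto
    have "?g a \<otimes> ?g b = x \<otimes> a \<otimes> ((inv x \<otimes> x) \<otimes> b) \<otimes> inv x"
      using x ab by (simp only: m_assoc m_closed inv_closed)
    also have "\<dots> = ?g (a \<otimes> b)"
      using x ab by (simp add: m_assoc)
    finally show ?thesis by simp
  qed
  have "left_haar_measure (G\<lparr>carrier := N\<rparr>) (subtopology T N) ?\<nu>"
    unfolding left_haar_measure_def
  proof (intro conjI ballI)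
    show "radon_measure (subtopology T N) ?\<nu>"
      by (rule N.radon_distr[OF h])
    have "emeasure ?\<nu> (space \<nu>) = emeasure \<nu> (space \<nu>)"
      using measurable_space[OF N.homeomorphic_measurable[OF h]]
      by (subst emeasure_distr[OF N.homeomorphic_measurable[OF h] sets.top])
         (auto intro!: arg_cong[where f="emeasure \<nu>"])
    then show "emeasure ?\<nu> (space ?\<nu>) \<noteq> 0"
      using left_haar_subgroup by (simp add: left_haar_measure_def)
    fix a E assume a: "a \<in> carrier (G\<lparr>carrier := N\<rparr>)" and "E \<in> sets ?\<nu>"
    then have aN: "a \<in> N" and E: "E \<in> sets \<nu>" by auto
    have "(\<lambda>n. a \<otimes> n) ` E = a <#\<^bsub>G\<lparr>carrier := N\<rparr>\<^esub> E"
      by (auto simp: l_coset_def)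
    moreover have "homeomorphic_maps (subtopology T N) (subtopology T N)
        (\<lambda>n. inv\<^bsub>G\<lparr>carrier := N\<rparr>\<^esub> a \<otimes> n) (\<lambda>n. a \<otimes> n)"
      using N.homeomorphic_maps_left_translation[OF a] homeomorphic_maps_sym by fastforce
    ultimately have aE: "a <#\<^bsub>G\<lparr>carrier := N\<rparr>\<^esub> E \<in> sets \<nu>"
      using N.homeomorphic_image_sets[OF _ E] by metis
    have "?g ` (a <#\<^bsub>G\<lparr>carrier := N\<rparr>\<^esub> E) = ?g a <#\<^bsub>G\<lparr>carrier := N\<rparr>\<^esub> (?g ` E)"
      using gmult[OF aN] EN[OF E] by (auto simp: l_coset_def image_iff subset_iff)
    then show "emeasure ?\<nu> (a <#\<^bsub>G\<lparr>carrier := N\<rparr>\<^esub> E) = emeasure ?\<nu> E"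
      using em[OF aE] em[OF E] N.emeasure_l_coset[OF _ gsets[OF E], of "?g a"] conjugate_closed[OF x aN]
      by simp
  qed
  then obtain c where c: "c > 0" "\<And>E. E \<in> sets \<nu> \<Longrightarrow> emeasure ?\<nu> E = ennreal c * emeasure \<nu> E"
    using N.left_haar_measure_unique by metis
  obtain K where K: "K \<in> sets \<nu>" "0 < emeasure \<nu> K" "emeasure \<nu> K < \<infinity>"
    using N.finite_positive_set by metis
  have mc: "m \<in> carrier (G\<lparr>carrier := N\<rparr>)" "?g m \<in> carrier (G\<lparr>carrier := N\<rparr>)"
    using m conjugate_closed[OF x m] by auto
  have Km: "K #>\<^bsub>G\<lparr>carrier := N\<rparr>\<^esub> m \<in> sets \<nu>"
    by (rule N.r_coset_sets[OF mc(1) K(1)])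
  have "?g ` (K #>\<^bsub>G\<lparr>carrier := N\<rparr>\<^esub> m) = (?g ` K) #>\<^bsub>G\<lparr>carrier := N\<rparr>\<^esub> ?g m"
    using gmult[OF _ m] EN[OF K(1)] by (auto simp: r_coset_def image_iff subset_iff)
  then have "emeasure \<nu> ((?g ` K) #>\<^bsub>G\<lparr>carrier := N\<rparr>\<^esub> ?g m)
      = ennreal c * emeasure \<nu> (K #>\<^bsub>G\<lparr>carrier := N\<rparr>\<^esub> m)"
    using em[OF Km] c(2)[OF Km] by metis
  moreover have "emeasure \<nu> (?g ` K) = ennreal c * emeasure \<nu> K"
    using em[OF K(1)] c(2)[OF K(1)] by metis
  ultimately have "ennreal (?\<Delta> (?g m)) * (ennreal c * emeasure \<nu> K) = ennreal c * (ennreal (?\<Delta> m) * emeasure \<nu> K)"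
    using N.emeasure_r_coset[OF mc(2) gsets[OF K(1)]] N.emeasure_r_coset[OF mc(1) K(1)] by metis
  then have "ennreal (?\<Delta> (?g m) * c) * emeasure \<nu> K = ennreal (?\<Delta> m * c) * emeasure \<nu> K"
    using c(1) N.modular_function_pos[OF mc(1)] N.modular_function_pos[OF mc(2)]
    by (simp add: ennreal_mult less_imp_le mult.assoc mult.left_commute)
  then have "?\<Delta> (?g m) * c = ?\<Delta> m * c"
    using c(1) N.modular_function_pos[OF mc(1)] N.modular_function_pos[OF mc(2)]
    by (intro N.ennreal_scale_eqD[OF K(2,3)]) auto
  then show ?thesis
    using c(1) by simp
qed

text \<open>
  Both orbit averages of a right translate by \<open>m \<in> N\<close> are known: averaging over \<open>N\<close> from the left
  after translating by \<open>m\<close> is averaging after conjugating \<open>m\<close> past the argument, so that one average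
  is scaled by \<open>\<Delta>\<^sub>N\<close> and the other is unchanged, while the integral over \<open>G\<close> is scaled by \<open>\<Delta>\<^sub>G\<close>.
\<close>

lemma modular_function_normal_subgroup:
  assumes m: "m \<in> N"
  shows "modular_function (G\<lparr>carrier := N\<rparr>) (subtopology T N) m = modular_function G T m"
proof -
  let ?\<Delta> = "modular_function (G\<lparr>carrier := N\<rparr>) (subtopology T N)"
  have mG: "m \<in> carrier G"
    by (rule N_subset[OF m])
  \<comment> \<open>Nonnegativity and the value 1 at the identity make \<open>I\<close> positive, so
    that the double integral can be cancelled at the end.\<close>
  obtain f where f: "f \<in> Cc T" "\<And>x. x \<in> carrier G \<Longrightarrow> 0 \<le> f x" "f \<one> = (1::real)"
    using positive_Cc_exists by metis
  define f' where "f' x = f (x \<otimes> m)" for x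
  have f': "f' \<in> Cc T"
    unfolding f'_def using Cc_homeomorphic_compose[OF homeomorphic_maps_right_translation[OF mG] f(1)] .
  define avg where "avg x = (\<integral>n. f (n \<otimes> x) \<partial>\<nu>)" for x
  have avg_cont: "continuous_map T euclideanreal avg"
    unfolding avg_def by (rule continuous_map_orbit_integral[OF f(1)])
  have favg: "(\<lambda>x. f x * avg x) \<in> Cc T"
    by (rule Cc_mult[OF f(1) avg_cont])
  define I where "I = (\<integral>x. f x * avg x \<partial>\<mu>)"
  have f_right: "(\<lambda>n. f (n \<otimes> x)) \<in> Cc (subtopology T N)" if "x \<in> carrier G" for x
    by (rule Cc_restrict[OF Cc_homeomorphic_compose[OF homeomorphic_maps_right_translation[OF that] f(1)]])
  have "I > 0"
    unfolding I_def
  proof (rule integral_Cc_pos[OF favg])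
    show "f x * avg x \<ge> 0" if "x \<in> carrier G" for x
      using f(2) that N_subset unfolding avg_def
      by (intro mult_nonneg_nonneg Bochner_Integration.integral_nonneg) auto
    have "avg \<one> > 0"
      unfolding avg_def
      by (rule N.integral_Cc_pos[OF f_right, of \<one> \<one>])
         (use f(2,3) N_subset subgroup.one_closed[OF subgroup] in auto)
    then show "f \<one> * avg \<one> > 0"
      using f(3) by simp
  qed simp
  define k where "k x = x \<otimes> m \<otimes> inv x" for x
  have k: "k x \<in> N" "k x \<in> carrier G" "x \<otimes> m = k x \<otimes> x" if "x \<in> carrier G" for x
    using conjugate_closed[OF that m] N_subset that mG by (auto simp: k_def m_assoc)
  \<comment> \<open>Since x m = k(x) x with k(x) in \<open>N\<close>, translating \<open>f\<close>
    by \<open>m\<close> amounts to translating n on the right by k(x). The factor \<Delta>_N(k(x)) =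
    \<Delta>_N(m) is free of x, so it can leave the integral over x.\<close>
  have avg': "?\<Delta> m * (\<integral>n. f' (n \<otimes> x) \<partial>\<nu>) = avg x" if x: "x \<in> carrier G" for x
  proof -
    have "(\<integral>n. f' (n \<otimes> x) \<partial>\<nu>) = (\<integral>n. f ((n \<otimes> k x) \<otimes> x) \<partial>\<nu>)"
      using x k[OF x] mG N_subset
      by (intro Bochner_Integration.integral_cong) (auto simp: f'_def m_assoc)
    moreover have "?\<Delta> (k x) * (\<integral>n. f ((n \<otimes> k x) \<otimes> x) \<partial>\<nu>) = avg x"
      using N.integral_right_translation[OF _ f_right[OF x], of "k x"] k(1)[OF x] by (simp add: avg_def)
    ultimately show ?thesis
      using modular_function_conjugate[OF x m] by (simp add: k_def)
  qed
  \<comment> \<open>With n inverted, k(x) acts by a left translation, n^-1 k(x) = (k(x)^-1 n)^-1,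
    under which \<open>\<nu>\<close> is invariant.\<close>
  have coavg: "(\<integral>n. f' (inv n \<otimes> x) \<partial>\<nu>) = (\<integral>n. f (inv n \<otimes> x) \<partial>\<nu>)" if x: "x \<in> carrier G" for x
  proof -
    let ?u = "\<lambda>n. f (inv n \<otimes> (k x \<otimes> x))"
    have "?u \<in> Cc T"
      using Cc_homeomorphic_compose[OF homeomorphic_maps_inv
          Cc_homeomorphic_compose[OF homeomorphic_maps_right_translation f(1)]] k[OF x] x by simp
    then have "(\<integral>n. ?u (k x \<otimes> n) \<partial>\<nu>) = (\<integral>n. ?u n \<partial>\<nu>)"
      using N.integral_left_translation[OF _ Cc_restrict, of "k x" ?u] k(1)[OF x] by simp
    moreover have "(\<integral>n. ?u (k x \<otimes> n) \<partial>\<nu>) = (\<integral>n. f (inv n \<otimes> x) \<partial>\<nu>)"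
    proof (rule Bochner_Integration.integral_cong[OF refl])
      fix n assume "n \<in> space \<nu>"
      then have n: "n \<in> carrier G" using N_subset by simp
      have "inv (k x \<otimes> n) \<otimes> (k x \<otimes> x) = inv n \<otimes> ((inv (k x) \<otimes> k x) \<otimes> x)"
        using n x k(2)[OF x] by (simp only: inv_mult_group m_assoc m_closed inv_closed)
      then show "?u (k x \<otimes> n) = f (inv n \<otimes> x)"
        using n x k(2)[OF x] by simp
    qed
    moreover have "(\<integral>n. f' (inv n \<otimes> x) \<partial>\<nu>) = (\<integral>n. ?u n \<partial>\<nu>)"
      using x k(3)[OF x] mG N_subset
      by (intro Bochner_Integration.integral_cong) (auto simp: f'_def m_assoc)
    ultimately show ?thesis by simp
  qed
  \<comment> \<open>Both factors are values at x m of functions independent of \<open>m\<close>, so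
    right translation in the whole group applies to their product.\<close>
  have "modular_function G T m * (\<integral>x. f' x * (\<integral>n. f' (n \<otimes> x) \<partial>\<nu>) \<partial>\<mu>) = I"
  proof -
    have "(\<integral>x. f' x * (\<integral>n. f' (n \<otimes> x) \<partial>\<nu>) \<partial>\<mu>) = (\<integral>x. f (x \<otimes> m) * avg (x \<otimes> m) \<partial>\<mu>)"
    proof (rule Bochner_Integration.integral_cong[OF refl])
      fix x assume "x \<in> space \<mu>"
      then have x: "x \<in> carrier G" using topspace_eq by simp
      have "(\<integral>n. f' (n \<otimes> x) \<partial>\<nu>) = avg (x \<otimes> m)"
        unfolding avg_def f'_def using x mG N_subset
        by (intro Bochner_Integration.integral_cong) (auto simp: m_assoc)
      then show "f' x * (\<integral>n. f' (n \<otimes> x) \<partial>\<nu>) = f (x \<otimes> m) * avg (x \<otimes> m)"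
        by (simp add: f'_def)
    qed
    then show ?thesis
      using integral_right_translation[OF mG favg] by (simp add: I_def)
  qed
  \<comment> \<open>After one swap, \<open>f'\<close> may be replaced by \<open>f\<close> under the
    inverted average. Swapping back leaves \<open>f'\<close> only inside the plain average, where
    \<Delta>_N(m) turns it into that of \<open>f\<close>.\<close>
  moreover have "?\<Delta> m * (\<integral>x. f' x * (\<integral>n. f' (n \<otimes> x) \<partial>\<nu>) \<partial>\<mu>) = I"
  proof -
    have "(\<integral>x. f' x * (\<integral>n. f' (n \<otimes> x) \<partial>\<nu>) \<partial>\<mu>) = (\<integral>x. f' x * (\<integral>n. f' (inv n \<otimes> x) \<partial>\<nu>) \<partial>\<mu>)"
      by (rule orbit_integral_swap[OF f' f'])
    also have "\<dots> = (\<integral>x. f' x * (\<integral>n. f (inv n \<otimes> x) \<partial>\<nu>) \<partial>\<mu>)"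
      using coavg by (intro Bochner_Integration.integral_cong[OF refl]) (simp add: topspace_eq)
    also have "\<dots> = (\<integral>x. f x * (\<integral>n. f' (n \<otimes> x) \<partial>\<nu>) \<partial>\<mu>)"
      by (rule orbit_integral_swap[OF f(1) f', symmetric])
    finally have "?\<Delta> m * (\<integral>x. f' x * (\<integral>n. f' (n \<otimes> x) \<partial>\<nu>) \<partial>\<mu>)
        = (\<integral>x. ?\<Delta> m * (f x * (\<integral>n. f' (n \<otimes> x) \<partial>\<nu>)) \<partial>\<mu>)"
      by simp
    also have "\<dots> = I"
      unfolding I_def using avg' topspace_eq
      by (intro Bochner_Integration.integral_cong[OF refl]) (simp add: mult.left_commute)
    finally show ?thesis .
  qed
  ultimately have "modular_function G T m * (\<integral>x. f' x * (\<integral>n. f' (n \<otimes> x) \<partial>\<nu>) \<partial>\<mu>)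
      = ?\<Delta> m * (\<integral>x. f' x * (\<integral>n. f' (n \<otimes> x) \<partial>\<nu>) \<partial>\<mu>)"
    and "(\<integral>x. f' x * (\<integral>n. f' (n \<otimes> x) \<partial>\<nu>) \<partial>\<mu>) \<noteq> 0"
    using \<open>I > 0\<close> by auto
  then show ?thesis
    by simp
qed

end

end

section \<open>The rho-function criterion and the conclusion\<close>

lemma (in locally_compact_group) haar_subgroup_exists:
  assumes "subgroup H G" "closedin T H"
  obtains \<mu> \<nu> where "haar_subgroup G T \<mu> H \<nu>"
proof -
  interpret H: locally_compact_group "G\<lparr>carrier := H\<rparr>" "subtopology T H"
    by (rule locally_compact_group_subgroup[OF assms])
  obtain \<mu> where "left_haar_measure G T \<mu>"
    using left_haar_measure_exists by metis
  moreover obtain \<nu> where "left_haar_measure (G\<lparr>carrier := H\<rparr>) (subtopology T H) \<nu>"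
    using H.left_haar_measure_exists by metis
  ultimately show thesis
    using assms that[of \<mu> \<nu>] locally_compact_group_axioms
    by (simp add: haar_subgroup_def haar_subgroup_axioms_def haar_def haar_axioms_def)
qed

lemma (in haar_subgroup) almost_unimodular_iff_rho_function:
  assumes "almost_unimodular G T" and "rho_function G T N \<rho>"
  shows "almost_unimodular (G\<lparr>carrier := N\<rparr>) (subtopology T N) \<longleftrightarrow>
    openin (subtopology T N) {t \<in> N. \<rho> t = \<rho> \<one>}"
proof -
  let ?S = "subtopology T N"
  let ?\<Delta> = "modular_function G T" and ?\<Delta>N = "modular_function (G\<lparr>carrier := N\<rparr>) ?S"
  let ?A = "{t \<in> N. ?\<Delta>N t = 1}" and ?B = "{t \<in> N. \<rho> t = \<rho> \<one>}"
  have one: "\<one> \<in> N"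
    using subgroup.one_closed[OF subgroup] .
  have mult: "s \<otimes> t \<in> N" if "s \<in> N" "t \<in> N" for s t
    using subgroup.m_closed[OF subgroup that] .
  have hom: "?\<Delta> (s \<otimes> t) = ?\<Delta> s * ?\<Delta> t" "?\<Delta>N (s \<otimes> t) = ?\<Delta>N s * ?\<Delta>N t" if "s \<in> N" "t \<in> N" for s t
    using modular_function_mult[of s t] N.modular_function_mult[of s t] that N_subset by auto
  have \<rho>1: "\<rho> \<one> > 0"
    using assms(2) by (auto simp: rho_function_def continuous_map_def topspace_eq)
  \<comment> \<open>The condition on \<open>\<rho>\<close> thus cuts out the set where two
    homomorphisms agree, which is closed under products.\<close>
  have B: "\<rho> t = \<rho> \<one> \<longleftrightarrow> ?\<Delta>N t = ?\<Delta> t" if t: "t \<in> N" for t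
  proof -
    have "\<rho> (\<one> \<otimes> t) = ?\<Delta>N t / ?\<Delta> t * \<rho> \<one>"
      using assms(2) t one_closed unfolding rho_function_def by blast
    then have "\<rho> t = ?\<Delta>N t / ?\<Delta> t * \<rho> \<one>"
      using N_subset[OF t] by simp
    then have "\<rho> t = \<rho> \<one> \<longleftrightarrow> ?\<Delta>N t / ?\<Delta> t = 1"
      using \<rho>1 mult_cancel_right2[of "?\<Delta>N t / ?\<Delta> t" "\<rho> \<one>"] by auto
    then show ?thesis
      using modular_function_pos[OF N_subset[OF t]] by auto
  qed
  have "openin T {s \<in> carrier G. ?\<Delta> s = 1}"
    using assms(1) by (simp add: almost_unimodular_def)
  then have K: "openin ?S ({s \<in> carrier G. ?\<Delta> s = 1} \<inter> N)"
    by (auto simp: openin_subtopology)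
  show "almost_unimodular (G\<lparr>carrier := N\<rparr>) ?S \<longleftrightarrow> openin ?S ?B"
    unfolding almost_unimodular_def partial_object.simps
  proof
    assume "openin ?S {s \<in> carrier (G\<lparr>carrier := N\<rparr>). ?\<Delta>N s = 1}"
    then have A: "openin ?S ?A"
      by simp
    show "openin ?S ?B"
    proof (rule N.openin_of_identity_neighbourhood)
      \<comment> \<open>On this neighbourhood both modular functions are 1, so multiplication by its
        elements preserves their equality.\<close>
      show "openin ?S (?A \<inter> ({s \<in> carrier G. ?\<Delta> s = 1} \<inter> N))"
        by (rule openin_Int[OF A K])
    qed (use one mult hom B modular_function_one N.modular_function_one in auto)
  next
    assume B': "openin ?S ?B"
    have "openin ?S ?A"
    proof (rule N.openin_of_identity_neighbourhood)
      \<comment> \<open>Equality of the modular functions together with \<Delta>_G = 1 forces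
        \<Delta>_N = 1 on this neighbourhood.\<close>
      show "openin ?S (?B \<inter> ({s \<in> carrier G. ?\<Delta> s = 1} \<inter> N))"
        by (rule openin_Int[OF B' K])
    qed (use one mult hom B modular_function_one N.modular_function_one in auto)
    then show "openin ?S {s \<in> carrier (G\<lparr>carrier := N\<rparr>). ?\<Delta>N s = 1}"
      by simp
  qed
qed

lemma (in haar_subgroup) almost_unimodular_normal_subgroup:
  assumes "almost_unimodular G T" and "N \<lhd> G"
  shows "almost_unimodular (G\<lparr>carrier := N\<rparr>) (subtopology T N)"
proof -
  have "{s \<in> N. modular_function (G\<lparr>carrier := N\<rparr>) (subtopology T N) s = 1}
      = {s \<in> carrier G. modular_function G T s = 1} \<inter> N"
    using modular_function_normal_subgroup[OF assms(2)] N_subset by auto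
  then show "almost_unimodular (G\<lparr>carrier := N\<rparr>) (subtopology T N)"
    using assms(1) by (auto simp: almost_unimodular_def openin_subtopology)
qed

theorem proposition3p1:
  fixes G :: "('a, 'b) monoid_scheme" and T :: "'a topology"
  assumes "locally_compact_group G T"
    and "almost_unimodular G T"
  shows "(\<forall>H \<rho>. subgroup H G \<longrightarrow> closedin T H \<longrightarrow> rho_function G T H \<rho> \<longrightarrow>
            (almost_unimodular (G\<lparr>carrier := H\<rparr>) (subtopology T H) \<longleftrightarrow>
             openin (subtopology T H) {t \<in> H. \<rho> t = \<rho> \<one>\<^bsub>G\<^esub>})) \<and>
         (\<forall>N. N \<lhd> G \<longrightarrow> closedin T N \<longrightarrow>
            almost_unimodular (G\<lparr>carrier := N\<rparr>) (subtopology T N))"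
proof (intro conjI allI impI)
  fix H \<rho> assume H: "subgroup H G" "closedin T H" and \<rho>: "rho_function G T H \<rho>"
  obtain \<mu> \<nu> where "haar_subgroup G T \<mu> H \<nu>"
    using locally_compact_group.haar_subgroup_exists[OF assms(1) H] by metis
  then show "almost_unimodular (G\<lparr>carrier := H\<rparr>) (subtopology T H) \<longleftrightarrow>
      openin (subtopology T H) {t \<in> H. \<rho> t = \<rho> \<one>\<^bsub>G\<^esub>}"
    using haar_subgroup.almost_unimodular_iff_rho_function assms(2) \<rho> by metis
next
  fix N assume N: "N \<lhd> G" "closedin T N"
  obtain \<mu> \<nu> where "haar_subgroup G T \<mu> N \<nu>"
    using locally_compact_group.haar_subgroup_exists[OF assms(1) normal_imp_subgroup[OF N(1)] N(2)] by metis
  then show "almost_unimodular (G\<lparr>carrier := N\<rparr>) (subtopology T N)"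
    using haar_subgroup.almost_unimodular_normal_subgroup assms(2) N(1) by metis
qed

end
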